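(* For $F\in\Pi$, $$F=\frac12\sum_{w}[[w]]\,\Theta_w ,$$ where the sum is over all $\mathbf{c}\mathbf{d}$-words $w$ and $[[w]]=[[w]]_F$ is the coefficient of $w$ in the $\mathbf{c}-2\mathbf{d}$-index of $F$.
   Context: Let $\mathcal{Q}$ be the algebra of quasisymmetric functions over $\mathbb{Q}$ in $x_1,x_2,\dots$: the linear span of $M_0=1$ and $M_\beta=\sum_{i_1<\cdots<i_k}x_{i_1}^{\beta_1}\cdots x_{i_k}^{\beta_k}$ for compositions $\beta=(\beta_1,\dots,\beta_k)$. $\mathcal{Q}_{m}$ is the subspace of homogeneous elements of degree $m$. Put $[n]=\{1,\dots,n\}$, $[0]=\emptyset$. For $n\ge0$ and $S=\{i_1<\dots<i_k\}\subset[n]$ let $M_S=M_S^{(n+1)}=M_{(i_1,i_2-i_1,\dots,i_k-i_{k-1},n+1-i_k)}\in\mathcal{Q}_{n+1}$ (so $M_\emptyset^{(n+1)}=M_{(n+1)}$); these form a basis of $\mathcal{Q}_{n+1}$. $S\subset[n]$ is left sparse if $1\notin S$ and $i\in S\Rightarrow i-1\notin S$; it is right sparse if $n\notin S$ and $i\in S\Rightarrow i+1\notin S$. For $S\subset[n]$ left sparse, $\Theta_S=\sum_{T\subset[n]:\,S\subset T\cup(T+1)}2^{|T|+1}M_T^{(n+1)}$, where $T+1=\{i+1: i\in T\}$. The peak algebra $\Pi$ is the subalgebra of $\mathcal{Q}$ generated by all $\Theta_S$ ($n\ge0$, $S\subset[n]$ left sparse). A $\mathbf{c}\mathbf{d}$-word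 is a (possibly empty) word in noncommuting letters $\mathbf{c},\mathbf{d}$ of degrees 1 and 2; $|w|_{\mathbf d}$ is the number of $\mathbf d$'s in $w$. For $w=\mathbf{c}^{n_1}\mathbf{d}\mathbf{c}^{n_2}\mathbf{d}\cdots\mathbf{c}^{n_k}\mathbf{d}\mathbf{c}^{m}$ of degree $n$, $S_w=\{n_1+2,\,n_1+n_2+4,\dots,n_1+\cdots+n_k+2k\}\subset[n]$ (left sparse), and $\Theta_w=\Theta_{S_w}\in\Pi_{n+1}=\Pi\cap\mathcal{Q}_{n+1}$. For $S\subset[n]$, $K_S=\sum_{S\subset T\subset[n]}2^{|T|-|S|}M_T^{(n+1)}$; these form a basis of $\mathcal{Q}_{n+1}$. For $F\in\mathcal{Q}_{n+1}$ write $F=\sum_{S\subset[n]}k_SK_S$. The $\mathbf{c}\mathbf{d}$-index coefficients $[w]=[w]_F$ ($w$ of degree $n$) are the unique numbers such that for every right sparse $S\subset[n]$, $k_S=\sum[w]$, summed over words $w$ of degree $n$ with $|w|_{\mathbf d}=|S|$ and $S_w\cap\{i,i+1\}\ne\emptyset$ for all $i\in S$. For non-homogeneous $F\in\mathcal{Q}$, $[w]_F=[w]_{F_i}$, where $F_i$ is the homogeneous component of $F$ of degree $\deg w+1$. The $\mathbf{c}-2\mathbf{d}$-index coefficients are $[[w]]_F=2^{-|w|_{\mathbf d}}[w]_F$.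
   Formalization: The subalgebra Π generated by the Θ_S is taken without adjoining the unit 1, so F has zero constant term; for F with nonzero constant term (e.g. F = 1) the identity fails, since every Θ_w has positive degree. *)

theory Defs
  imports Complex_Main "HOL-Library.FuncSet" "HOL-Library.Poly_Mapping"
begin

section \<open>Formal power series over the rationals in countably many variables\<close>

text \<open>
  The variables are indexed by \<open>nat\<close>, so index \<open>i\<close> stands for \<open>x\<^sub>i\<^sub>+\<^sub>1\<close>; only the order of the indices
  matters below.  A monomial is its finitely supported exponent function.
\<close>

type_synonym monomial = "nat \<Rightarrow>\<^sub>0 nat"

definition mdegree :: "monomial \<Rightarrow> nat" where
  "mdegree m = (\<Sum>i\<in>Poly_Mapping.keys m. Poly_Mapping.lookup m i)"

typedef qps = "UNIV :: (monomial \<Rightarrow> rat) set"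
  morphisms qcoeff Abs_qps ..

setup_lifting type_definition_qps

lemma qps_eq_iff: "f = g \<longleftrightarrow> (\<forall>m. qcoeff f m = qcoeff g m)"
  by transfer auto

definition splits :: "monomial \<Rightarrow> (monomial \<times> monomial) set" where
  "splits m = {(a, b). a + b = m}"

lemma finite_splits: "finite (splits m)"
proof -
  let ?A = "{a::monomial. \<exists>b. a + b = m}"
  let ?B = "PiE (Poly_Mapping.keys m) (\<lambda>i. {..Poly_Mapping.lookup m i})"
  let ?r = "\<lambda>a::monomial. restrict (Poly_Mapping.lookup a) (Poly_Mapping.keys m)"
  have le: "Poly_Mapping.lookup a i \<le> Poly_Mapping.lookup m i" if "a \<in> ?A" for a i
    using that by (auto simp: lookup_add)
  have "inj_on ?r ?A"
  proof (rule inj_onI)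
    fix a b assume ab: "a \<in> ?A" "b \<in> ?A" "?r a = ?r b"
    show "a = b"
    proof (rule poly_mapping_eqI)
      fix i
      show "Poly_Mapping.lookup a i = Poly_Mapping.lookup b i"
      proof (cases "i \<in> Poly_Mapping.keys m")
        case True
        then show ?thesis using fun_cong[OF ab(3), of i] by simp
      next
        case False
        then show ?thesis using le[OF ab(1), of i] le[OF ab(2), of i] by (simp add: in_keys_iff)
      qed
    qed
  qed
  moreover have "?r ` ?A \<subseteq> ?B"
    using le by auto
  moreover have "finite ?B"
    by (intro finite_PiE) auto
  ultimately have fA: "finite ?A"
    by (rule inj_on_finite)
  have "splits m \<subseteq> ?A \<times> ?A"
  proof
    fix p assume "p \<in> splits m"
    then have "fst p + snd p = m" "snd p + fst p = m"
      by (auto simp: splits_def add.commute)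
    then show "p \<in> ?A \<times> ?A"
      unfolding mem_Times_iff mem_Collect_eq by blast
  qed
  then show ?thesis
    by (rule finite_subset) (simp add: fA)
qed

instantiation qps :: comm_ring_1
begin

lift_definition zero_qps :: qps is "\<lambda>m. 0" .
lift_definition one_qps :: qps is "\<lambda>m. if m = 0 then 1 else 0" .
lift_definition plus_qps :: "qps \<Rightarrow> qps \<Rightarrow> qps" is "\<lambda>f g m. f m + g m" .
lift_definition uminus_qps :: "qps \<Rightarrow> qps" is "\<lambda>f m. - f m" .
lift_definition minus_qps :: "qps \<Rightarrow> qps \<Rightarrow> qps" is "\<lambda>f g m. f m - g m" .
lift_definition times_qps :: "qps \<Rightarrow> qps \<Rightarrow> qps" is
  "\<lambda>f g m. \<Sum>(a, b)\<in>splits m. f a * g b" .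

instance
proof
  fix f g h :: qps
  show "f * g = g * f"
  proof transfer
    fix f g :: "monomial \<Rightarrow> rat"
    show "(\<lambda>m. \<Sum>(a, b)\<in>splits m. f a * g b) = (\<lambda>m. \<Sum>(a, b)\<in>splits m. g a * f b)"
    proof
      fix m
      show "(\<Sum>(a, b)\<in>splits m. f a * g b) = (\<Sum>(a, b)\<in>splits m. g a * f b)"
        by (rule sum.reindex_bij_witness[of _ prod.swap prod.swap])
           (auto simp: splits_def add.commute mult.commute)
    qed
  qed
  show "f * g * h = f * (g * h)"
  proof transfer
    fix f g h :: "monomial \<Rightarrow> rat"
    show "(\<lambda>m. \<Sum>(a, b)\<in>splits m. (\<Sum>(a, b)\<in>splits a. f a * g b) * h b)
        = (\<lambda>m. \<Sum>(a, b)\<in>splits m. f a * (\<Sum>(a, b)\<in>splits b. g a * h b))"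
    proof
      fix m
      have "(\<Sum>(a, b)\<in>splits m. (\<Sum>(a, b)\<in>splits a. f a * g b) * h b)
          = (\<Sum>p\<in>splits m. \<Sum>q\<in>splits (fst p). f (fst q) * g (snd q) * h (snd p))"
        by (simp add: case_prod_beta sum_distrib_right)
      also have "\<dots> = (\<Sum>(p, q)\<in>(SIGMA p:splits m. splits (fst p)). f (fst q) * g (snd q) * h (snd p))"
        by (rule sum.Sigma) (auto simp: finite_splits)
      also have "\<dots> = (\<Sum>(p, q)\<in>(SIGMA p:splits m. splits (snd p)). f (fst p) * (g (fst q) * h (snd q)))"
        by (rule sum.reindex_bij_witness[of _
              "\<lambda>(p, q). ((fst p + fst q, snd q), (fst p, fst q))"
              "\<lambda>(p, q). ((fst q, snd q + snd p), (snd q, snd p))"])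
           (auto simp: splits_def add.assoc mult.assoc)
      also have "\<dots> = (\<Sum>p\<in>splits m. \<Sum>q\<in>splits (snd p). f (fst p) * (g (fst q) * h (snd q)))"
        by (rule sum.Sigma[symmetric]) (auto simp: finite_splits)
      also have "\<dots> = (\<Sum>(a, b)\<in>splits m. f a * (\<Sum>(a, b)\<in>splits b. g a * h b))"
        by (simp add: case_prod_beta sum_distrib_left)
      finally show "(\<Sum>(a, b)\<in>splits m. (\<Sum>(a, b)\<in>splits a. f a * g b) * h b)
          = (\<Sum>(a, b)\<in>splits m. f a * (\<Sum>(a, b)\<in>splits b. g a * h b))" .
    qed
  qed
  show "1 * f = f"
  proof transfer
    fix f :: "monomial \<Rightarrow> rat"
    show "(\<lambda>m. \<Sum>(a, b)\<in>splits m. (if a = 0 then 1 else 0) * f b) = f"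
    proof
      fix m
      have "(\<Sum>(a, b)\<in>splits m. (if a = 0 then 1 else 0) * f b)
          = (\<Sum>(a, b)\<in>{(0::monomial, m)}. (if a = 0 then 1 else 0) * f b)"
        by (rule sum.mono_neutral_right[OF finite_splits]) (auto simp: splits_def split: if_splits)
      then show "(\<Sum>(a, b)\<in>splits m. (if a = 0 then 1 else 0) * f b) = f m"
        by simp
    qed
  qed
  show "(f + g) * h = f * h + g * h"
    by transfer (simp add: case_prod_beta distrib_right sum.distrib)
  show "(0::qps) \<noteq> 1"
    by transfer (auto simp: fun_eq_iff)
  show "f + g + h = f + (g + h)" "f + g = g + f" "0 + f = f" "- f + f = 0" "f - g = f + - g"
    by (simp_all add: qps_eq_iff plus_qps.rep_eq minus_qps.rep_eq uminus_qps.rep_eq zero_qps.rep_eq)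
qed

end

lift_definition qscale :: "rat \<Rightarrow> qps \<Rightarrow> qps" (infixr \<open>*\<^sub>q\<close> 75) is "\<lambda>c f m. c * f m" .

interpretation qps: vector_space qscale
  by unfold_locales (simp_all add: qps_eq_iff plus_qps.rep_eq qscale.rep_eq distrib_left distrib_right)

lift_definition hcomp :: "nat \<Rightarrow> qps \<Rightarrow> qps" is
  "\<lambda>d f m. if mdegree m = d then f m else 0" .


section \<open>Quasisymmetric functions\<close>

text \<open>
  \<open>M \<beta>\<close> is the sum, over all strictly increasing index lists \<open>is\<close> of the length of \<open>\<beta>\<close>, of the monomials
  \<open>\<Prod>\<^sub>j x\<^bsub>is ! j\<^esub>\<^bsup>\<beta> ! j\<^esup>\<close>; the coefficient of a monomial counts how often it occurs.
\<close>

lift_definition M :: "nat list \<Rightarrow> qps" is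
  "\<lambda>\<beta> m. of_nat (card {is. sorted_wrt (<) is \<and> length is = length \<beta> \<and>
                          sum_list (map2 Poly_Mapping.single is \<beta>) = m})" .

definition composition :: "nat list \<Rightarrow> bool" where
  "composition \<beta> \<longleftrightarrow> (\<forall>b\<in>set \<beta>. b > 0)"

definition QSym :: "qps set" where
  "QSym = qps.span (M ` {\<beta>. composition \<beta>})"

definition comp_of :: "nat \<Rightarrow> nat set \<Rightarrow> nat list" where
  "comp_of n S = (let l = sorted_list_of_set S in map2 (-) (l @ [n + 1]) (0 # l))"

definition MS :: "nat \<Rightarrow> nat set \<Rightarrow> qps" where
  "MS n S = M (comp_of n S)"

definition K :: "nat \<Rightarrow> nat set \<Rightarrow> qps" where
  "K n S = (\<Sum>T | S \<subseteq> T \<and> T \<subseteq> {1..n}. 2 ^ (card T - card S) *\<^sub>q MS n T)"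

text \<open>
  Coordinates with respect to the basis \<open>K n S\<close>, \<open>S \<subseteq> {1..n}\<close>, of the degree \<open>n + 1\<close> part of
  \<open>QSym\<close>; setting them to \<open>0\<close> for all other \<open>S\<close> makes the total function unique.
\<close>

definition kcoeff :: "nat \<Rightarrow> qps \<Rightarrow> nat set \<Rightarrow> rat" where
  "kcoeff n F = (THE k. (\<forall>S. \<not> S \<subseteq> {1..n} \<longrightarrow> k S = 0) \<and>
                        F = (\<Sum>S | S \<subseteq> {1..n}. k S *\<^sub>q K n S))"


section \<open>The peak algebra\<close>

definition left_sparse :: "nat \<Rightarrow> nat set \<Rightarrow> bool" where
  "left_sparse n S \<longleftrightarrow> S \<subseteq> {1..n} \<and> 1 \<notin> S \<and> (\<forall>i\<in>S. i - 1 \<notin> S)"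

definition right_sparse :: "nat \<Rightarrow> nat set \<Rightarrow> bool" where
  "right_sparse n S \<longleftrightarrow> S \<subseteq> {1..n} \<and> n \<notin> S \<and> (\<forall>i\<in>S. i + 1 \<notin> S)"

definition Theta :: "nat \<Rightarrow> nat set \<Rightarrow> qps" where
  "Theta n S = (\<Sum>T | T \<subseteq> {1..n} \<and> S \<subseteq> T \<union> (\<lambda>i. i + 1) ` T. 2 ^ (card T + 1) *\<^sub>q MS n T)"

text \<open>
  Subalgebras are linear subspaces closed under multiplication; they need not contain \<open>1\<close>.  Hence the
  peak algebra generated by the \<open>Theta n S\<close>, all of positive degree, has no constants.  The unital
  version only adds multiples of \<open>1\<close>: these have no \<open>cd\<close>-index (a word of degree \<open>n\<close> belongs to the
  homogeneous component of degree \<open>n + 1\<close>), and the expansion in the \<open>Theta\<close> cannot represent them.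
\<close>

definition subalgebra :: "qps set \<Rightarrow> bool" where
  "subalgebra A \<longleftrightarrow> qps.subspace A \<and> (\<forall>f\<in>A. \<forall>g\<in>A. f * g \<in> A)"

definition peak_algebra :: "qps set" where
  "peak_algebra = (\<lambda>A. subalgebra A \<and> A \<subseteq> QSym) hull {Theta n S |n S. left_sparse n S}"


section \<open>The cd-index\<close>

datatype cd_letter = Letter_c | Letter_d

type_synonym cd_word = "cd_letter list"

definition deg :: "cd_word \<Rightarrow> nat" where
  "deg w = sum_list (map (\<lambda>l. case l of Letter_c \<Rightarrow> 1 | Letter_d \<Rightarrow> 2) w)"

definition num_d :: "cd_word \<Rightarrow> nat" where
  "num_d w = count_list w Letter_d"

text \<open>
  In \<open>c\<^sup>n\<^sup>1 d c\<^sup>n\<^sup>2 d \<dots>\<close> the prefix ending in the \<open>j\<close>-th \<open>d\<close> has degree \<open>n1 + \<dots> + nj + 2 j\<close>.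
\<close>

definition S_word :: "cd_word \<Rightarrow> nat set" where
  "S_word w = {deg (u @ [Letter_d]) |u v. w = u @ [Letter_d] @ v}"

definition Theta_word :: "cd_word \<Rightarrow> qps" where
  "Theta_word w = Theta (deg w) (S_word w)"

definition cd_index :: "nat \<Rightarrow> qps \<Rightarrow> cd_word \<Rightarrow> rat" where
  "cd_index n F = (THE c. (\<forall>w. deg w \<noteq> n \<longrightarrow> c w = 0) \<and>
     (\<forall>S. right_sparse n S \<longrightarrow>
        kcoeff n F S = (\<Sum>w | deg w = n \<and> num_d w = card S \<and>
                              (\<forall>i\<in>S. S_word w \<inter> {i, i + 1} \<noteq> {}). c w)))"

definition cd_coeff :: "qps \<Rightarrow> cd_word \<Rightarrow> rat" where
  "cd_coeff F w = cd_index (deg w) (hcomp (deg w + 1) F) w"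

definition c2d_coeff :: "qps \<Rightarrow> cd_word \<Rightarrow> rat" where
  "c2d_coeff F w = cd_coeff F w / 2 ^ num_d w"

end

theory Submission
  imports Defs
begin

text \<open>
  The peak algebra is controlled by a cancellation property.  A power series is said to cancel if
  substituting \<open>- t\<close> and \<open>t\<close> for two adjacent variables always gives a series that does not depend on
  \<open>t\<close>.  Since substitution is multiplicative, the cancelling quasisymmetric functions without constant
  term form an algebra (\<open>subalgebra_peak_space\<close>).  Each \<open>Theta n S\<close> belongs to it (\<open>cancels_Theta\<close>),
  hence so does every element of the peak algebra.

  A homogeneous quasisymmetric function of degree \<open>n + 1\<close> has one coefficient for each \<open>T \<subseteq> {1..n}\<close>, the set of
  partial sums of the exponents of a monomial.  If the function cancels, then its coefficients at right
  sparse \<open>T\<close> determine all others (\<open>eq_zero_if_right_sparse_vanish\<close>).  Thus the expansion has to be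
  verified only at right sparse \<open>T\<close>.

  There it is a count.  Passing from coordinates in the basis \<open>K\<close> to coefficients sums over the subsets \<open>S\<close> of
  \<open>T\<close>, which are again right sparse, and the cd-index writes the coordinate of \<open>S\<close> as a sum
  over words \<open>w\<close>.  A given word is counted once for each \<open>S \<subseteq> T\<close> of size \<open>num_d w\<close> whose elements \<open>i\<close>
  all satisfy \<open>S_word w \<inter> {i, i + 1} \<noteq> {}\<close>.  There is exactly one such \<open>S\<close> if
  \<open>S_word w \<subseteq> T \<union> (T + 1)\<close> and none otherwise (\<open>card_matchings\<close>); this is the condition for \<open>T\<close> to occur
  in \<open>Theta_word w\<close>.

  The coordinates \<open>kcoeff\<close> and \<open>cd_index\<close> are given by definite descriptions, so they have their
  intended meaning only because the linear systems that define them are uniquely solvable.  Both systems are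
  triangular (\<open>triangular_system_ex1\<close>).
\<close>

abbreviation "lookup \<equiv> Poly_Mapping.lookup"
abbreviation "keys \<equiv> Poly_Mapping.keys"
abbreviation "single \<equiv> Poly_Mapping.single"

section \<open>Triangular linear systems\<close>

text \<open>
  With the unknowns ordered by rank, the matrix is triangular with invertible diagonal.  An unknown
  of maximal rank occurs in its own equation only, so it can be split off: the remaining equations
  determine the other unknowns, and its own equation then determines it.  Both the coordinates in
  the basis \<open>K\<close> and the cd-index are solutions of such systems.
\<close>

lemma triangular_system_ex1:
  fixes A :: "'a \<Rightarrow> 'a \<Rightarrow> rat" and rank :: "'a \<Rightarrow> nat"
  assumes "finite I"
    and "\<And>i. i \<in> I \<Longrightarrow> A i i \<noteq> 0"
    and "\<And>i j. i \<in> I \<Longrightarrow> j \<in> I \<Longrightarrow> A i j \<noteq> 0 \<Longrightarrow> i = j \<or> rank j < rank i"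
  shows "\<exists>!c. (\<forall>i. i \<notin> I \<longrightarrow> c i = 0) \<and> (\<forall>i\<in>I. k i = (\<Sum>j\<in>I. A i j * c j))"
  using assms
proof (induction I rule: finite_ranking_induct[where f = rank])
  case empty
  show ?case by (rule ex1I[of _ "\<lambda>_. 0"]) auto
next
  case (insert x I)
  show ?case
  proof (cases "x \<in> I")
    case True
    then show ?thesis using insert by (simp add: insert_absorb)
  next
    case False
    have zero: "A i x = 0" if "i \<in> I" for i
      using insert.prems(2)[of i x] insert.hyps(2)[of i] that False by force
    have "\<exists>!c. (\<forall>i. i \<notin> I \<longrightarrow> c i = 0) \<and> (\<forall>i\<in>I. k i = (\<Sum>j\<in>I. A i j * c j))"
      using insert.prems by (intro insert.IH) auto
    then obtain c where c: "\<And>i. i \<notin> I \<Longrightarrow> c i = 0" "\<And>i. i \<in> I \<Longrightarrow> k i = (\<Sum>j\<in>I. A i j * c j)"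
      and uniq: "\<And>c'. (\<forall>i. i \<notin> I \<longrightarrow> c' i = 0) \<Longrightarrow> (\<forall>i\<in>I. k i = (\<Sum>j\<in>I. A i j * c' j)) \<Longrightarrow> c' = c"
      by (elim ex1E) blast
    have nz: "A x x \<noteq> 0" using insert.prems(1) by simp
    define d where "d = c(x := (k x - (\<Sum>j\<in>I. A x j * c j)) / A x x)"
    have same: "(\<Sum>j\<in>I. A i j * e j) = (\<Sum>j\<in>I. A i j * (e(x := v)) j)" for e v i
      using False by (intro sum.cong) auto
    show ?thesis
    proof (rule ex1I[of _ d])
      show "(\<forall>i. i \<notin> insert x I \<longrightarrow> d i = 0) \<and> (\<forall>i\<in>insert x I. k i = (\<Sum>j\<in>insert x I. A i j * d j))"
        using c zero nz insert.hyps(1) False by (auto simp: d_def same[symmetric] simp del: fun_upd_apply) (auto)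
    next
      fix e
      assume e: "(\<forall>i. i \<notin> insert x I \<longrightarrow> e i = 0) \<and> (\<forall>i\<in>insert x I. k i = (\<Sum>j\<in>insert x I. A i j * e j))"
      have "e(x := 0) = c"
        using e zero insert.hyps(1) False
        by (intro uniq) (auto simp: same[symmetric] simp del: fun_upd_apply, auto)
      then have ec: "e i = c i" if "i \<noteq> x" for i using that by (metis fun_upd_other)
      have "k x = A x x * e x + (\<Sum>j\<in>I. A x j * e j)"
        using e insert.hyps(1) False by simp
      moreover have "(\<Sum>j\<in>I. A x j * e j) = (\<Sum>j\<in>I. A x j * c j)"
        using ec False by (intro sum.cong) (simp, metis)
      ultimately have "e x = d x" using nz by (simp add: d_def field_simps)
      then show "e = d" using ec by (auto simp: d_def fun_eq_iff)
    qed
  qed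
qed

section \<open>Monomials, exponent lists and partial sums\<close>

text \<open>
  The monomial \<open>place ix \<alpha>\<close> is the expression in the definition of \<open>M\<close>.  The list \<open>\<alpha>\<close> may contain
  zeros, so that every factor of \<open>place ix \<beta>\<close> has the form \<open>place ix \<alpha>\<close> with the same \<open>ix\<close>.
\<close>

definition place :: "nat list \<Rightarrow> nat list \<Rightarrow> monomial" where
  "place ix \<alpha> = sum_list (map2 single ix \<alpha>)"

definition exponents :: "monomial \<Rightarrow> nat list" where
  "exponents m = map (lookup m) (sorted_list_of_set (keys m))"

lemma lookup_place_outside: "x \<notin> set ix \<Longrightarrow> lookup (place ix \<alpha>) x = 0"
proof (induction ix arbitrary: \<alpha>)
  case (Cons i ix)
  then show ?case by (cases \<alpha>) (auto simp: place_def lookup_add lookup_single when_def)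
qed (simp add: place_def)

lemma map_lookup_place:
  "distinct ix \<Longrightarrow> length \<alpha> = length ix \<Longrightarrow> map (lookup (place ix \<alpha>)) ix = \<alpha>"
proof (induction ix arbitrary: \<alpha>)
  case (Cons i ix)
  then obtain a \<alpha>' where \<alpha>: "\<alpha> = a # \<alpha>'" by (cases \<alpha>) auto
  have split: "place (i # ix) \<alpha> = single i a + place ix \<alpha>'"
    by (simp add: place_def \<alpha>)
  have "map (lookup (place (i # ix) \<alpha>)) ix = map (lookup (place ix \<alpha>')) ix"
    using Cons.prems(1) by (auto simp: split lookup_add lookup_single when_def)
  moreover have "lookup (place (i # ix) \<alpha>) i = a"
    using Cons.prems(1) by (simp add: split lookup_add lookup_place_outside)
  ultimately show ?case using Cons by (simp add: \<alpha> del: map_eq_conv)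
qed simp

lemma place_map_lookup:
  assumes "distinct ix" "keys m \<subseteq> set ix"
  shows "place ix (map (lookup m) ix) = m"
proof (rule poly_mapping_eqI)
  fix x
  show "lookup (place ix (map (lookup m) ix)) x = lookup m x"
  proof (cases "x \<in> set ix")
    case True
    then show ?thesis using map_lookup_place[OF assms(1), of "map (lookup m) ix"] by (simp add: map_eq_conv)
  next
    case False
    then have "lookup m x = 0" using assms(2) by (meson in_keys_iff subsetD)
    then show ?thesis using False by (simp add: lookup_place_outside)
  qed
qed

lemma place_exponents: "place (sorted_list_of_set (keys m)) (exponents m) = m"
  unfolding exponents_def by (rule place_map_lookup) auto

lemma exponents_eq_filter:
  assumes "sorted_wrt (<) ix" "keys m \<subseteq> set ix"
  shows "exponents m = filter (\<lambda>a. a \<noteq> 0) (map (lookup m) ix)"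
proof -
  have *: "keys m = set (filter (\<lambda>i. lookup m i \<noteq> 0) ix)"
    using assms(2) by (auto simp: in_keys_iff)
  have "sorted_list_of_set (keys m) = filter (\<lambda>i. lookup m i \<noteq> 0) ix"
    unfolding * by (intro sorted_list_of_set.idem_if_sorted_distinct)
       (use assms(1) in \<open>auto simp: strict_sorted_iff intro: sorted_filter[of "\<lambda>x. x", simplified]\<close>)
  then show ?thesis by (simp add: exponents_def filter_map o_def)
qed

lemma exponents_place:
  assumes "sorted_wrt (<) ix" "length \<alpha> = length ix"
  shows "exponents (place ix \<alpha>) = filter (\<lambda>a. a \<noteq> 0) \<alpha>"
proof -
  have "keys (place ix \<alpha>) \<subseteq> set ix"
    by (metis in_keys_iff lookup_place_outside subsetI)
  then show ?thesis
    using exponents_eq_filter[OF assms(1), of "place ix \<alpha>"] assms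
    by (simp add: map_lookup_place strict_sorted_iff)
qed

lemma composition_exponents: "composition (exponents m)"
  by (auto simp: composition_def exponents_def in_keys_iff)

lemma sum_list_exponents: "sum_list (exponents m) = mdegree m"
  by (simp add: exponents_def mdegree_def sum_list_distinct_conv_sum_set)

lemma filter_composition: "composition \<beta> \<Longrightarrow> filter ((<) 0) \<beta> = \<beta>"
  by (auto simp: composition_def filter_id_conv)

text \<open>
  As the parts of \<open>\<beta>\<close> are positive, the index list can only be the increasing enumeration of the
  variables that occur in \<open>m\<close>; so the number of lists counted is 0 or 1.
\<close>

lemma qcoeff_M:
  assumes "composition \<beta>"
  shows "qcoeff (M \<beta>) m = (if exponents m = \<beta> then 1 else 0)"
proof -
  let ?A = "{ix. sorted_wrt (<) ix \<and> length ix = length \<beta> \<and> sum_list (map2 single ix \<beta>) = m}"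
  let ?l = "sorted_list_of_set (keys m)"
  have "ix = ?l \<and> exponents m = \<beta>" if "ix \<in> ?A" for ix
  proof -
    have ix: "sorted_wrt (<) ix" "length ix = length \<beta>" "m = place ix \<beta>"
      using that by (auto simp: place_def)
    have eq: "exponents m = \<beta>"
      using exponents_place[of ix \<beta>] ix assms by (simp add: filter_composition)
    have d: "distinct ix" "sorted ix" using ix(1) by (auto simp: strict_sorted_iff)
    have mp: "map (lookup m) ix = \<beta>" using map_lookup_place[OF d(1)] ix by simp
    have "keys m = set ix"
    proof
      show "keys m \<subseteq> set ix" by (metis in_keys_iff ix(3) lookup_place_outside subsetI)
      show "set ix \<subseteq> keys m"
      proof
        fix x assume "x \<in> set ix"
        then have "lookup m x \<in> set \<beta>" using mp by (metis image_eqI set_map)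
        then show "x \<in> keys m" using assms by (auto simp: composition_def in_keys_iff)
      qed
    qed
    then show ?thesis using d eq by (simp add: sorted_list_of_set.idem_if_sorted_distinct)
  qed
  moreover have "?l \<in> ?A" if "exponents m = \<beta>"
    using that place_exponents[of m] by (auto simp: place_def exponents_def)
  ultimately have "?A = (if exponents m = \<beta> then {?l} else {})" by auto
  then show ?thesis by (simp add: M.rep_eq)
qed

text \<open>
  Subsets of \<open>{1..n}\<close> enter as the sets of partial sums of compositions, here completed by
  the two end points \<open>0\<close> and \<open>n + 1\<close>.  On monomials, partial sums of the exponents are
  taken over all variables: a variable with exponent zero repeats a value, so the set is the same as
  for the list of the nonzero exponents, and it is easy to follow when single exponents change.
\<close>

fun list_sums :: "nat list \<Rightarrow> nat set" where
  "list_sums [] = {0}"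
| "list_sums (b # \<beta>) = insert 0 ((+) b ` list_sums \<beta>)"

definition mono_sums :: "monomial \<Rightarrow> nat set" where
  "mono_sums m = range (\<lambda>k. \<Sum>l<k. lookup m l)"

lemma zero_in_list_sums: "0 \<in> list_sums \<beta>"
  by (cases \<beta>) auto

lemma list_sums_eq_take: "list_sums \<beta> = range (\<lambda>k. sum_list (take k \<beta>))"
proof (induction \<beta>)
  case (Cons b \<beta>)
  have "range (\<lambda>k. sum_list (take k (b # \<beta>))) = insert 0 (range (\<lambda>k. b + sum_list (take k \<beta>)))"
    (is "range ?f = insert 0 (range ?g)")
  proof -
    have "?f (Suc k) = ?g k" for k by simp
    moreover have "?f 0 = 0" by simp
    ultimately have *: "?f k = (case k of 0 \<Rightarrow> 0 | Suc j \<Rightarrow> ?g j)" for k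
      by (cases k) auto
    show ?thesis unfolding * by (auto simp: image_iff split: nat.splits)
  qed
  then show ?case by (simp add: Cons image_image)
qed auto

text \<open>
  The first part of a composition is its least nonzero partial sum; the rest follows by subtracting it.
\<close>

lemma list_sums_inj:
  "composition \<beta> \<Longrightarrow> composition \<gamma> \<Longrightarrow> list_sums \<beta> = list_sums \<gamma> \<Longrightarrow> \<beta> = \<gamma>"
proof (induction \<beta> arbitrary: \<gamma>)
  case Nil
  show ?case
  proof (cases \<gamma>)
    case (Cons c \<gamma>')
    then have "c \<in> list_sums \<gamma>" using zero_in_list_sums[of \<gamma>'] by force
    then show ?thesis using Nil Cons by (auto simp: composition_def)
  qed simp
next
  case (Cons b \<beta>)
  show ?case
  proof (cases \<gamma>)
    case Nil
    have "b \<in> list_sums (b # \<beta>)" using zero_in_list_sums[of \<beta>] by force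
    then show ?thesis using Nil Cons.prems by (auto simp: composition_def)
  next
    case (Cons c \<gamma>')
    have pos: "b > 0" "c > 0" using Cons.prems Cons by (auto simp: composition_def)
    have eq: "(+) b ` list_sums \<beta> = (+) c ` list_sums \<gamma>'"
    proof -
      have "(+) b ` list_sums \<beta> = list_sums (b # \<beta>) - {0}" using pos by auto
      also have "\<dots> = list_sums (c # \<gamma>') - {0}" using Cons.prems Cons by simp
      also have "\<dots> = (+) c ` list_sums \<gamma>'" using pos by auto
      finally show ?thesis .
    qed
    have "b \<in> (+) c ` list_sums \<gamma>'" using zero_in_list_sums[of \<beta>] eq by force
    moreover have "c \<in> (+) b ` list_sums \<beta>" using zero_in_list_sums[of \<gamma>'] eq by force
    ultimately have bc: "b = c" by auto
    then have "list_sums \<beta> = list_sums \<gamma>'" using eq by (simp add: inj_image_eq_iff)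
    then show ?thesis using Cons.IH[of \<gamma>'] Cons.prems Cons bc by (auto simp: composition_def)
  qed
qed

lemma filter_eq_takeWhile_less:
  "sorted_wrt (<) xs \<Longrightarrow> filter (\<lambda>i. i < k) xs = takeWhile (\<lambda>i. i < (k::nat)) xs"
proof (induction xs)
  case (Cons x xs)
  show ?case
  proof (cases "x < k")
    case False
    then have "filter (\<lambda>i. i < k) xs = []"
      using Cons.prems by (auto simp: filter_empty_conv)
    then show ?thesis using False by simp
  qed (use Cons in simp)
qed simp

lemma take_eq_filter_less:
  "sorted_wrt (<) xs \<Longrightarrow> \<exists>k'. filter (\<lambda>i. i < k') xs = take k (xs :: nat list)"
proof (induction xs arbitrary: k)
  case (Cons x xs)
  show ?case
  proof (cases "k = 0 \<or> take (k - 1) xs = []")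
    case True
    then have "filter (\<lambda>i. i < (if k = 0 then x else Suc x)) (x # xs) = take k (x # xs)"
      using Cons.prems by (cases k) (force simp: filter_empty_conv)+
    then show ?thesis ..
  next
    case False
    then obtain j where j: "k = Suc j" "take j xs \<noteq> []" by (cases k) auto
    obtain k' where k': "filter (\<lambda>i. i < k') xs = take j xs" using Cons.IH Cons.prems by auto
    then have "\<exists>y\<in>set xs. y < k'" using j by (metis filter_False)
    then have "x < k'" using Cons.prems by auto
    then show ?thesis using k' j by (intro exI[of _ k']) simp
  qed
qed simp

text \<open>
  Cutting the sum off at the variable \<open>k\<close> keeps an initial piece of the exponent list, and every
  initial piece arises in this way.
\<close>

lemma mono_sums_exponents: "mono_sums m = list_sums (exponents m)"
proof -
  let ?l = "sorted_list_of_set (keys m)"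
  have sl: "sorted_wrt (<) ?l" by simp
  have part: "(\<Sum>l<k. lookup m l) = sum_list (map (lookup m) (filter (\<lambda>i. i < k) ?l))" for k
  proof -
    have "(\<Sum>l<k. lookup m l) = (\<Sum>l\<in>{i \<in> keys m. i < k}. lookup m l)"
      by (rule sum.mono_neutral_right) (auto simp: in_keys_iff)
    also have "\<dots> = sum_list (map (lookup m) (filter (\<lambda>i. i < k) ?l))"
      by (subst sum_list_distinct_conv_sum_set) auto
    finally show ?thesis .
  qed
  have "filter (\<lambda>i. i < k) ?l = take (length (takeWhile (\<lambda>i. i < k) ?l)) ?l" for k
    using filter_eq_takeWhile_less[OF sl, of k] takeWhile_eq_take[of _ ?l] by metis
  moreover have "\<exists>k'. filter (\<lambda>i. i < k') ?l = take k ?l" for k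
    using take_eq_filter_less[OF sl] .
  ultimately show ?thesis
    unfolding mono_sums_def list_sums_eq_take part exponents_def
    by (auto simp: image_iff take_map) metis+
qed

text \<open>
  Partial sums of differences telescope.
\<close>

lemma list_sums_differences:
  "sorted_wrt (<) (x # l) \<Longrightarrow>
    list_sums (map2 (-) l (x # l)) = (\<lambda>y. y - x) ` set (x # l) \<and> composition (map2 (-) l (x # l))"
proof (induction l arbitrary: x)
  case (Cons y l)
  have IH: "list_sums (map2 (-) l (y # l)) = (\<lambda>z. z - y) ` set (y # l)"
    and comp: "composition (map2 (-) l (y # l))"
    using Cons.IH[of y] Cons.prems by auto
  have "(+) (y - x) ` (\<lambda>z. z - y) ` set (y # l) = (\<lambda>z. z - x) ` set (y # l)"
    unfolding image_image using Cons.prems by (intro image_cong) auto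
  moreover have "list_sums (map2 (-) (y # l) (x # y # l))
      = insert 0 ((+) (y - x) ` list_sums (map2 (-) l (y # l)))" by simp
  ultimately have "list_sums (map2 (-) (y # l) (x # y # l)) = insert 0 ((\<lambda>z. z - x) ` set (y # l))"
    by (simp only: IH)
  then show ?case using comp Cons.prems by (auto simp: composition_def)
qed (simp add: composition_def)

lemma
  assumes "S \<subseteq> {1..n}"
  shows list_sums_comp_of: "list_sums (comp_of n S) = S \<union> {0, n + 1}"
    and composition_comp_of: "composition (comp_of n S)"
proof -
  have fin: "finite S" using assms finite_subset by auto
  define l where "l = sorted_list_of_set S @ [n + 1]"
  have sl: "sorted_wrt (<) (0 # l)"
    using assms fin by (auto simp: l_def sorted_wrt_append)
  have "comp_of n S = map2 (-) l (0 # l)"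
  proof -
    have "zip xs (ys @ zs) = zip xs ys" if "length xs = length ys" for xs ys zs :: "nat list"
      using that by (induction xs ys rule: list_induct2) auto
    from this[of l "0 # sorted_list_of_set S" "[n + 1]"] show ?thesis
      by (simp add: comp_of_def l_def Let_def)
  qed
  then show "list_sums (comp_of n S) = S \<union> {0, n + 1}" "composition (comp_of n S)"
    using list_sums_differences[OF sl] fin by (auto simp: l_def)
qed

lemma exponents_eq_comp_of_iff:
  assumes "S \<subseteq> {1..n}"
  shows "exponents m = comp_of n S \<longleftrightarrow> mono_sums m = S \<union> {0, n + 1}"
  unfolding mono_sums_exponents list_sums_comp_of[OF assms, symmetric]
  using list_sums_inj[OF composition_exponents[of m] composition_comp_of[OF assms]] by metis

lemma qcoeff_MS:
  assumes "S \<subseteq> {1..n}"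
  shows "qcoeff (MS n S) m = (if mono_sums m = S \<union> {0, n + 1} then 1 else 0)"
  unfolding MS_def qcoeff_M[OF composition_comp_of[OF assms]] exponents_eq_comp_of_iff[OF assms]
  by (rule refl)

lemma mono_sums_bounds: "mdegree m \<in> mono_sums m" "mono_sums m \<subseteq> {..mdegree m}" "0 \<in> mono_sums m"
proof -
  have "mdegree m = sum_list (take (length (exponents m)) (exponents m))"
    by (simp add: sum_list_exponents)
  then show "mdegree m \<in> mono_sums m"
    unfolding mono_sums_exponents list_sums_eq_take by blast
  have "sum_list (take k xs) \<le> sum_list xs" for k and xs :: "nat list"
    by (metis append_take_drop_id le_add1 sum_list_append)
  then show "mono_sums m \<subseteq> {..mdegree m}"
    unfolding mono_sums_exponents list_sums_eq_take by (auto simp: sum_list_exponents[symmetric])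
  show "0 \<in> mono_sums m" by (simp add: mono_sums_exponents zero_in_list_sums)
qed

lemma mdegree_eq_Max: "mdegree m = Max (mono_sums m)"
  using mono_sums_bounds[of m] finite_subset[OF mono_sums_bounds(2) finite_atMost]
  by (intro Max_eqI[symmetric]) auto

section \<open>Quasisymmetric functions by their coefficients\<close>

definition quasisymmetric :: "qps \<Rightarrow> bool" where
  "quasisymmetric F \<longleftrightarrow> (\<forall>m m'. exponents m = exponents m' \<longrightarrow> qcoeff F m = qcoeff F m')"

lemma quasisymmetricD:
  "quasisymmetric F \<Longrightarrow> exponents m = exponents m' \<Longrightarrow> qcoeff F m = qcoeff F m'"
  unfolding quasisymmetric_def by blast

definition bounded_degree :: "qps \<Rightarrow> bool" where
  "bounded_degree F \<longleftrightarrow> (\<exists>N. \<forall>m. mdegree m > N \<longrightarrow> qcoeff F m = 0)"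

lemmas qps_rep_eqs = zero_qps.rep_eq plus_qps.rep_eq minus_qps.rep_eq qscale.rep_eq

lemma qcoeff_sum: "qcoeff (\<Sum>x\<in>A. f x) m = (\<Sum>x\<in>A. qcoeff (f x) m)"
  by (induction A rule: infinite_finite_induct) (auto simp: qps_rep_eqs)

text \<open>
  This intrinsic description is what makes \<open>QSym\<close> accessible to products and to comparison of
  coefficients.  A series of this kind is \<open>\<Sum>f \<beta> M\<^sub>\<beta>\<close>, where \<open>f \<beta>\<close> is its coefficient at
  any monomial with exponent list \<open>\<beta>\<close>; bounded degree makes the sum finite.
\<close>

lemma QSym_iff: "F \<in> QSym \<longleftrightarrow> quasisymmetric F \<and> bounded_degree F"
proof
  assume "F \<in> QSym"
  then show "quasisymmetric F \<and> bounded_degree F"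
    unfolding QSym_def
  proof (induction rule: qps.span_induct_alt)
    case base
    show ?case by (simp add: quasisymmetric_def bounded_degree_def qps_rep_eqs)
  next
    case (step c x y)
    then obtain \<beta> where \<beta>: "composition \<beta>" "x = M \<beta>" by auto
    from step obtain N where N: "\<And>m. mdegree m > N \<Longrightarrow> qcoeff y m = 0"
      by (auto simp: bounded_degree_def)
    have "qcoeff (c *\<^sub>q x + y) m = 0" if "mdegree m > max N (sum_list \<beta>)" for m
      using that N[of m] sum_list_exponents[of m] \<beta> by (auto simp: qps_rep_eqs qcoeff_M)
    moreover have "quasisymmetric (c *\<^sub>q x + y)"
      unfolding quasisymmetric_def
    proof (intro allI impI)
      fix m m' assume "exponents m = exponents m'"
      moreover from this have "qcoeff y m = qcoeff y m'"
        using step.IH by (intro quasisymmetricD) simp_all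
      ultimately show "qcoeff (c *\<^sub>q x + y) m = qcoeff (c *\<^sub>q x + y) m'"
        by (simp add: qps_rep_eqs \<beta> qcoeff_M)
    qed
    ultimately show ?case unfolding bounded_degree_def by blast
  qed
next
  assume F: "quasisymmetric F \<and> bounded_degree F"
  then obtain N where N: "\<And>m. mdegree m > N \<Longrightarrow> qcoeff F m = 0"
    by (auto simp: bounded_degree_def)
  define B where "B = {\<beta>. composition \<beta> \<and> sum_list \<beta> \<le> N}"
  have len: "length \<beta> \<le> sum_list \<beta>" if "composition \<beta>" for \<beta>
    using that by (induction \<beta>) (auto simp: composition_def)
  have "B \<subseteq> {\<beta>. set \<beta> \<subseteq> {..N} \<and> length \<beta> \<le> N}"
  proof
    fix \<beta> assume "\<beta> \<in> B"
    then have "composition \<beta>" "sum_list \<beta> \<le> N" by (auto simp: B_def)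
    moreover from this have "x \<le> N" if "x \<in> set \<beta>" for x
      using member_le_sum_list[of x \<beta>] that by simp
    ultimately show "\<beta> \<in> {\<beta>. set \<beta> \<subseteq> {..N} \<and> length \<beta> \<le> N}"
      using len[of \<beta>] by auto
  qed
  then have fin: "finite B" by (rule finite_subset) (simp add: finite_lists_length_le)
  define f where "f \<beta> = qcoeff F (place [0..<length \<beta>] \<beta>)" for \<beta>
  have f: "qcoeff F m = f (exponents m)" for m
    unfolding f_def
  proof (rule quasisymmetricD)
    show "exponents m = exponents (place [0..<length (exponents m)] (exponents m))"
      by (simp add: exponents_place filter_composition composition_exponents)
  qed (use F in simp)
  have "F = (\<Sum>\<beta>\<in>B. f \<beta> *\<^sub>q M \<beta>)"
  proof (unfold qps_eq_iff, intro allI)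
    fix m
    have "qcoeff (\<Sum>\<beta>\<in>B. f \<beta> *\<^sub>q M \<beta>) m = (\<Sum>\<beta>\<in>B. if exponents m = \<beta> then f \<beta> else 0)"
      unfolding qcoeff_sum by (intro sum.cong) (auto simp: qps_rep_eqs qcoeff_M B_def)
    also have "\<dots> = (if exponents m \<in> B then f (exponents m) else 0)"
      using fin by simp
    also have "\<dots> = qcoeff F m"
      using N[of m] f[of m] by (auto simp: B_def composition_exponents sum_list_exponents)
    finally show "qcoeff F m = qcoeff (\<Sum>\<beta>\<in>B. f \<beta> *\<^sub>q M \<beta>) m" by (rule sym)
  qed
  also have "\<dots> \<in> QSym"
    unfolding QSym_def
    by (rule qps.span_sum, rule qps.span_scale, rule qps.span_base) (auto simp: B_def)
  finally show "F \<in> QSym" .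
qed

section \<open>Products of quasisymmetric functions\<close>

lemma mdegree_add: "mdegree (a + b) = mdegree a + mdegree b"
proof -
  have *: "mdegree m = (\<Sum>i\<in>keys a \<union> keys b. lookup m i)" if "keys m \<subseteq> keys a \<union> keys b" for m
    unfolding mdegree_def using that by (intro sum.mono_neutral_left) (auto simp: in_keys_iff)
  show ?thesis
    using *[of a] *[of b] *[of "a + b"] keys_add[of a b] by (simp add: lookup_add sum.distrib)
qed

lemma bounded_degree_times:
  assumes "bounded_degree F" "bounded_degree G"
  shows "bounded_degree (F * G)"
proof -
  obtain N where N: "\<And>m. mdegree m > N \<Longrightarrow> qcoeff F m = 0"
    using assms(1) by (auto simp: bounded_degree_def)
  obtain N' where N': "\<And>m. mdegree m > N' \<Longrightarrow> qcoeff G m = 0"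
    using assms(2) by (auto simp: bounded_degree_def)
  have "qcoeff (F * G) m = 0" if "mdegree m > N + N'" for m
  proof -
    have "qcoeff F a * qcoeff G b = 0" if "(a, b) \<in> splits m" for a b
    proof -
      have "mdegree a + mdegree b = mdegree m" using that by (auto simp: splits_def mdegree_add)
      then show ?thesis using N[of a] N'[of b] \<open>mdegree m > N + N'\<close> by fastforce
    qed
    then show ?thesis by (auto simp: times_qps.rep_eq intro: sum.neutral)
  qed
  then show ?thesis unfolding bounded_degree_def by blast
qed

text \<open>
  The factorizations of \<open>place ix \<beta>\<close> correspond to the entrywise decompositions of \<open>\<beta>\<close>.  As these do
  not involve \<open>ix\<close>, neither does the coefficient of a product of quasisymmetric series.
\<close>

definition list_splits :: "nat list \<Rightarrow> (nat list \<times> nat list) set" where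
  "list_splits \<beta> = {(\<alpha>, \<gamma>). length \<alpha> = length \<beta> \<and> length \<gamma> = length \<beta> \<and> map2 (+) \<alpha> \<gamma> = \<beta>}"

lemma qcoeff_times_place:
  assumes ix: "sorted_wrt (<) ix" and len: "length \<beta> = length ix"
  shows "qcoeff (F * G) (place ix \<beta>) =
    (\<Sum>(\<alpha>, \<gamma>)\<in>list_splits \<beta>. qcoeff F (place ix \<alpha>) * qcoeff G (place ix \<gamma>))"
proof -
  have d: "distinct ix" using ix by (simp add: strict_sorted_iff)
  have add: "place ix (map2 (+) \<alpha> \<gamma>) = place ix \<alpha> + place ix \<gamma>"
    if "length \<alpha> = length ix" "length \<gamma> = length ix" for \<alpha> \<gamma>
    using that
  proof (induction ix arbitrary: \<alpha> \<gamma>)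
    case (Cons i ix)
    then obtain a \<alpha>' c \<gamma>' where "\<alpha> = a # \<alpha>'" "\<gamma> = c # \<gamma>'" by (cases \<alpha>; cases \<gamma>) auto
    then show ?case using Cons by (simp add: place_def single_add add_ac)
  qed (simp add: place_def)
  have inv: "place ix (map (lookup a) ix) = a" "place ix (map (lookup b) ix) = b"
    if "a + b = place ix \<beta>" for a b
  proof -
    have "lookup a x = 0 \<and> lookup b x = 0" if "x \<notin> set ix" for x
      using lookup_place_outside[OF that, of \<beta>] by (simp add: \<open>a + b = _\<close>[symmetric] lookup_add)
    then have "keys a \<subseteq> set ix" "keys b \<subseteq> set ix" by (auto simp: in_keys_iff)
    then show "place ix (map (lookup a) ix) = a" "place ix (map (lookup b) ix) = b"
      by (auto intro!: place_map_lookup d)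
  qed
  have sum: "map2 (+) (map (lookup a) ix) (map (lookup b) ix) = \<beta>" if "a + b = place ix \<beta>" for a b
  proof -
    have "map2 (+) (map (lookup a) ix) (map (lookup b) ix) = map (lookup (a + b)) ix"
      by (induction ix) (auto simp: lookup_add)
    then show ?thesis using that map_lookup_place[OF d len] by simp
  qed
  show ?thesis
    unfolding times_qps.rep_eq
    by (rule sum.reindex_bij_witness[of _ "\<lambda>(\<alpha>, \<gamma>). (place ix \<alpha>, place ix \<gamma>)"
          "\<lambda>(a, b). (map (lookup a) ix, map (lookup b) ix)"])
      (auto simp: splits_def list_splits_def inv sum add len map_lookup_place d simp del: map_eq_conv)
qed

lemma quasisymmetric_times:
  assumes "quasisymmetric F" "quasisymmetric G"
  shows "quasisymmetric (F * G)"
  unfolding quasisymmetric_def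
proof (intro allI impI)
  fix m m' assume eq: "exponents m = exponents m'"
  let ?l = "sorted_list_of_set (keys m)" and ?l' = "sorted_list_of_set (keys m')"
  let ?\<beta> = "exponents m"
  have len: "length ?\<beta> = length ?l" "length ?\<beta> = length ?l'"
    using eq by (simp_all add: exponents_def) (metis length_map length_sorted_list_of_set)
  have F: "qcoeff F (place ?l \<alpha>) = qcoeff F (place ?l' \<alpha>)"
    and G: "qcoeff G (place ?l \<alpha>) = qcoeff G (place ?l' \<alpha>)"
    if "length \<alpha> = length ?\<beta>" for \<alpha>
    using exponents_place[of ?l \<alpha>] exponents_place[of ?l' \<alpha>] that len
    by (auto intro!: quasisymmetricD[OF assms(1)] quasisymmetricD[OF assms(2)])
  have "qcoeff (F * G) (place ?l ?\<beta>) = qcoeff (F * G) (place ?l' ?\<beta>)"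
    unfolding qcoeff_times_place[OF sorted_list_of_set.strict_sorted_key_list_of_set len(1)]
      qcoeff_times_place[OF sorted_list_of_set.strict_sorted_key_list_of_set len(2)]
    by (intro sum.cong) (auto simp: list_splits_def F G)
  then show "qcoeff (F * G) m = qcoeff (F * G) m'"
    using place_exponents[of m] place_exponents[of m'] eq by simp
qed

lemma QSym_times: "F \<in> QSym \<Longrightarrow> G \<in> QSym \<Longrightarrow> F * G \<in> QSym"
  by (simp add: QSym_iff quasisymmetric_times bounded_degree_times)

section \<open>Cancellation of adjacent variables\<close>

text \<open>
  For a monomial \<open>m\<close> without the variables \<open>i\<close> and \<open>Suc i\<close>, this is the coefficient of \<open>m t\<^sup>b\<close> in the series
  obtained from \<open>F\<close> by substituting \<open>- t\<close> for the variable \<open>i\<close> and \<open>t\<close> for the variable \<open>Suc i\<close>.  So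
  \<open>cancels F\<close> says that no such substitution depends on \<open>t\<close>.  Read on compositions, these are
  the Bayer-Billera (generalized Dehn-Sommerville) relations.
\<close>

definition alt_sum :: "nat \<Rightarrow> monomial \<Rightarrow> nat \<Rightarrow> qps \<Rightarrow> rat" where
  "alt_sum i m b F = (\<Sum>j\<le>b. (-1) ^ j * qcoeff F (m + single i j + single (Suc i) (b - j)))"

definition cancels :: "qps \<Rightarrow> bool" where
  "cancels F \<longleftrightarrow> (\<forall>i m b. lookup m i = 0 \<longrightarrow> lookup m (Suc i) = 0 \<longrightarrow> 0 < b \<longrightarrow> alt_sum i m b F = 0)"

text \<open>
  Setting the exponents of two adjacent variables to zero recovers \<open>m\<close> from the monomials in \<open>alt_sum i m b\<close>.
\<close>

definition erase :: "nat \<Rightarrow> monomial \<Rightarrow> monomial" where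
  "erase i x = x - single i (lookup x i) - single (Suc i) (lookup x (Suc i))"

lemma lookup_erase: "lookup (erase i x) l = (if l = i \<or> l = Suc i then 0 else lookup x l)"
  by (auto simp: erase_def lookup_minus lookup_single when_def)

lemma erase_add: "erase i (x + y) = erase i x + erase i y"
  by (rule poly_mapping_eqI) (simp add: lookup_erase lookup_add)

lemma erase_line:
  assumes "lookup p i = 0" "lookup p (Suc i) = 0"
  shows "erase i (p + single i j + single (Suc i) l) = p"
  by (rule poly_mapping_eqI) (auto simp: lookup_erase lookup_add lookup_single when_def assms)

lemma line_erase: "erase i x + single i (lookup x i) + single (Suc i) (lookup x (Suc i)) = x"
  by (rule poly_mapping_eqI) (auto simp: lookup_erase lookup_add lookup_single when_def)

lemma lookup_line:
  "lookup (p + single i j + single (Suc i) l) i = lookup p i + j"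
  "lookup (p + single i j + single (Suc i) l) (Suc i) = lookup p (Suc i) + l"
  by (auto simp: lookup_add lookup_single when_def)

text \<open>
  Substitution is multiplicative.  A factorization \<open>x y\<close> of a monomial on the left is
  determined by the factorization \<open>p q\<close> of \<open>m\<close> that remains after erasing the two variables and by the
  exponents of the two variables in \<open>x\<close> and in \<open>y\<close>; the signs multiply, since the exponents of the
  variable \<open>i\<close> add up.
\<close>

lemma alt_sum_times:
  assumes m: "lookup m i = 0" "lookup m (Suc i) = 0"
  shows "alt_sum i m b (F * G) =
    (\<Sum>(p, q)\<in>splits m. \<Sum>c\<le>b. alt_sum i p c F * alt_sum i q (b - c) G)"
proof -
  let ?line = "\<lambda>p b j. p + single i j + single (Suc i) (b - j)"
  let ?L = "SIGMA j:{..b}. splits (?line m b j)"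
  let ?R = "SIGMA pq:splits m. SIGMA c:{..b}. {..c} \<times> {..b - c}"
  let ?f = "\<lambda>(j, x, y). (-1) ^ j * (qcoeff F x * qcoeff G y)"
  let ?g = "\<lambda>((p, q), c, j, l). ((-1) ^ j * qcoeff F (?line p c j)) * ((-1) ^ l * qcoeff G (?line q (b - c) l))"
  let ?to = "\<lambda>((p, q), c, j, l). (j + l, ?line p c j, ?line q (b - c) l)"
  let ?from = "\<lambda>(j, x, y). ((erase i x, erase i y), lookup x i + lookup x (Suc i), lookup x i, lookup y i)"
  have zero: "lookup p i = 0" "lookup p (Suc i) = 0" "lookup q i = 0" "lookup q (Suc i) = 0"
    if "p + q = m" for p q
    using m that by (auto simp: lookup_add)
  have coords: "lookup x i + lookup y i = j \<and> lookup x (Suc i) + lookup y (Suc i) = b - j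
      \<and> erase i x + erase i y = m" if "x + y = ?line m b j" for x y j
    using arg_cong[OF that, of "\<lambda>z. lookup z i"] arg_cong[OF that, of "\<lambda>z. lookup z (Suc i)"]
      arg_cong[OF that, of "erase i"] m
    by (simp add: lookup_line lookup_add[of x y] erase_add[of i x y] erase_line)
  have "alt_sum i m b (F * G) = (\<Sum>t\<in>?L. ?f t)"
    by (simp add: alt_sum_def times_qps.rep_eq sum_distrib_left sum.Sigma finite_splits case_prod_beta)
  also have "\<dots> = (\<Sum>t\<in>?R. ?g t)"
  proof (rule sum.reindex_bij_witness[of _ ?to ?from])
    fix t assume t: "t \<in> ?L"
    obtain j x y where txy: "t = (j, x, y)" by (cases t)
    have j: "j \<le> b" and xy: "x + y = ?line m b j" using t by (auto simp: txy splits_def)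
    note fr = coords[OF xy]
    have diff: "lookup x i + lookup x (Suc i) - lookup x i = lookup x (Suc i)"
      "b - (lookup x i + lookup x (Suc i) + lookup y i) = lookup y (Suc i)"
      using fr j by linarith+
    show to_from: "?to (?from t) = t"
      using fr by (simp add: txy diff line_erase)
    show "?from t \<in> ?R"
      using fr j by (auto simp: txy splits_def)
    show "?g (?from t) = ?f t"
      using fr by (simp add: txy diff line_erase power_add[symmetric] flip: mult.assoc)
  next
    fix t assume t: "t \<in> ?R"
    obtain p q c j l where tpq: "t = ((p, q), c, j, l)" by (metis surj_pair)
    have le: "c \<le> b" "j \<le> c" "l \<le> b - c" and pq: "p + q = m" using t by (auto simp: tpq splits_def)
    note z = zero[OF pq]
    show "?from (?to t) = t"
      using z le by (simp add: tpq erase_line lookup_line)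
    have "single (Suc i) (c - j) + single (Suc i) (b - c - l) = single (Suc i) (b - (j + l))"
      unfolding single_add[symmetric] using le by (intro arg_cong[of _ _ "single (Suc i)"]) linarith
    from this[symmetric] have "?line p c j + ?line q (b - c) l = ?line m b (j + l)"
      by (simp add: pq[symmetric] single_add add_ac)
    then show "?to t \<in> ?L"
      using le by (auto simp: tpq splits_def)
  qed
  also have "\<dots> = (\<Sum>(p, q)\<in>splits m. \<Sum>c\<le>b. alt_sum i p c F * alt_sum i q (b - c) G)"
    by (simp add: alt_sum_def sum_product sum.Sigma sum.cartesian_product finite_splits finite_SigmaI case_prod_beta)
  finally show ?thesis .
qed

text \<open>
  If \<open>b > 0\<close>, then \<open>c\<close> or \<open>b - c\<close> is positive, so one of the two factors of each term vanishes.
\<close>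

lemma cancels_times:
  assumes "cancels F" "cancels G"
  shows "cancels (F * G)"
  unfolding cancels_def
proof (intro allI impI)
  fix i and m :: monomial and b :: nat assume m: "lookup m i = 0" "lookup m (Suc i) = 0" and b: "0 < b"
  have "alt_sum i p c F * alt_sum i q (b - c) G = 0" if "(p, q) \<in> splits m" "c \<le> b" for p q c
  proof -
    have "lookup p i = 0" "lookup p (Suc i) = 0" "lookup q i = 0" "lookup q (Suc i) = 0"
      using that m by (auto simp: splits_def lookup_add)
    then show ?thesis using assms b unfolding cancels_def by (cases "c = 0") auto
  qed
  then show "alt_sum i m b (F * G) = 0"
    unfolding alt_sum_times[OF m] by (intro sum.neutral ballI) (auto intro!: sum.neutral)
qed

lemma alt_sum_linear:
  "alt_sum i m b 0 = 0"
  "alt_sum i m b (F + G) = alt_sum i m b F + alt_sum i m b G"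
  "alt_sum i m b (F - G) = alt_sum i m b F - alt_sum i m b G"
  "alt_sum i m b (c *\<^sub>q F) = c * alt_sum i m b F"
  by (simp_all add: alt_sum_def qps_rep_eqs algebra_simps sum.distrib sum_subtractf sum_distrib_left)

lemma cancels_linear:
  "cancels 0"
  "cancels F \<Longrightarrow> cancels G \<Longrightarrow> cancels (F + G)"
  "cancels F \<Longrightarrow> cancels G \<Longrightarrow> cancels (F - G)"
  "cancels F \<Longrightarrow> cancels (c *\<^sub>q F)"
  unfolding cancels_def alt_sum_linear by simp_all

text \<open>
  Distributing an exponent \<open>b\<close> over two adjacent variables changes the partial sums in one place only:
  as the share of the first one grows from \<open>0\<close> to \<open>b\<close>, the sum after it moves from \<open>a\<close> to \<open>a + b\<close>,
  across a gap of the other partial sums.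
  This translates \<open>cancels\<close> into relations between coefficients indexed by sets.
\<close>

lemma mono_sums_line:
  fixes b :: nat
  assumes m: "lookup m i = 0" "lookup m (Suc i) = 0"
  defines "a \<equiv> \<Sum>l<i. lookup m l" and "W \<equiv> mono_sums (m + single (Suc i) b)"
  shows "j \<le> b \<Longrightarrow> mono_sums (m + single i j + single (Suc i) (b - j)) = insert (a + j) W"
    and "a \<in> W" and "a + b \<in> W" and "x \<in> W \<Longrightarrow> x \<le> a \<or> a + b \<le> x"
proof -
  define s where "s k = (\<Sum>l<k. lookup m l)" for k
  have s: "s i = a" "s (Suc i) = a" "s (Suc (Suc i)) = a" using m by (simp_all add: s_def a_def)
  have mono: "s k \<le> s k'" if "k \<le> k'" for k k'
    unfolding s_def using that by (intro sum_mono2) auto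
  define L where "L = s ` {..i}"
  define R where "R = (\<lambda>k. s k + b) ` {Suc (Suc i)..}"
  have line: "mono_sums (m + single i j + single (Suc i) (b - j)) = insert (a + j) (L \<union> R)"
    if "j \<le> b" for j
  proof -
    have part: "(\<Sum>l<k. lookup (m + single i j + single (Suc i) (b - j)) l)
        = s k + (if i < k then j else 0) + (if Suc i < k then b - j else 0)" for k
      by (simp add: s_def lookup_add lookup_single sum.distrib when_def)
    have eq: "(\<Sum>l<k. lookup (m + single i j + single (Suc i) (b - j)) l)
        = (if k \<le> i then s k else if k = Suc i then a + j else s k + b)" for k
      unfolding part using s that by auto
    have "UNIV = {..i} \<union> {Suc i} \<union> {Suc (Suc i)..}" by auto
    then show ?thesis
      unfolding mono_sums_def eq L_def R_def by (auto simp: image_Un cong: image_cong)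
  qed
  have aL: "a \<in> L" using s by (auto simp: L_def)
  have W: "W = L \<union> R" using line[of 0] aL by (auto simp: W_def insert_absorb)
  show "j \<le> b \<Longrightarrow> mono_sums (m + single i j + single (Suc i) (b - j)) = insert (a + j) W"
    using line W by simp
  show "a \<in> W" using aL W by simp
  show "a + b \<in> W" using s(3) by (auto simp: W R_def image_iff intro!: bexI[of _ "Suc (Suc i)"])
  show "x \<in> W \<Longrightarrow> x \<le> a \<or> a + b \<le> x"
    using mono s(1,3) by (fastforce simp: W L_def R_def)
qed

text \<open>
  Conversely, every gap of length at least two in a set of partial sums comes from such a situation: let the exponent of the variable
  \<open>w \<in> W\<close> be the distance from \<open>w\<close> to the previous element of \<open>W\<close>.  Then the variable \<open>c\<close> carries the
  whole gap, and the variable \<open>c - 1\<close> before it has exponent zero because \<open>c - 1 \<notin> W\<close>.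
\<close>

lemma exists_line:
  assumes fin: "finite W" and zero: "0 \<in> W" and ac: "a \<in> W" "c \<in> W" "a < c" "c - 1 \<notin> W"
    and gap: "\<And>x. x \<in> W \<Longrightarrow> x \<le> a \<or> c \<le> x"
  obtains m i where "lookup m i = 0" "lookup m (Suc i) = 0" "(\<Sum>l<i. lookup m l) = a"
    "mono_sums (m + single (Suc i) (c - a)) = W"
proof -
  \<comment> \<open>the partial sum over the variables below \<open>k\<close>\<close>
  define pr where "pr k = Max (insert 0 {v \<in> W. v < k})" for k
  have pr0: "pr 0 = 0" by (simp add: pr_def)
  have pr_in: "pr k \<in> W" for k
    using Max_in[of "insert 0 {v \<in> W. v < k}"] fin zero by (auto simp: pr_def)
  have pr_le: "pr k \<le> k" for k
    using fin by (simp add: pr_def)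
  have prSuc: "pr (Suc k) = (if k \<in> W then k else pr k)" for k
  proof (cases "k \<in> W")
    case True
    then show ?thesis using fin by (auto simp: pr_def intro!: Max_eqI)
  next
    case False
    then have "{v \<in> W. v < Suc k} = {v \<in> W. v < k}" by (auto simp: less_Suc_eq)
    then show ?thesis using False by (simp add: pr_def)
  qed
  define f where "f l = pr (Suc l) - pr l" for l
  have "{l. f l \<noteq> 0} \<subseteq> W" by (auto simp: f_def prSuc split: if_splits)
  then have "finite {l. f l \<noteq> 0}" using fin finite_subset by blast
  then obtain M where M: "lookup M = f"
    by (metis eq_onp_same_args lookup_Abs_poly_mapping mem_Collect_eq)
  have psum: "(\<Sum>l<k. f l) = pr k" for k
    by (induction k) (auto simp: pr0 f_def prSuc pr_le)
  have sums: "mono_sums M = W"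
  proof -
    have "w = pr (Suc w)" if "w \<in> W" for w using that by (simp add: prSuc)
    then show ?thesis using pr_in unfolding mono_sums_def M psum by blast
  qed
  define i where "i = c - 1"
  have c: "c = Suc i" "i \<notin> W" using ac by (auto simp: i_def)
  have pri: "pr i = a"
    unfolding pr_def
  proof (intro Max_eqI)
    show "y \<le> a" if "y \<in> insert 0 {v \<in> W. v < i}" for y
      using that gap[of y] c by auto
    show "a \<in> insert 0 {v \<in> W. v < i}"
      using ac c by (auto simp: less_Suc_eq)
  qed (use fin in simp)
  then have look: "lookup M i = 0" "lookup M (Suc i) = c - a"
    using c ac by (simp_all add: M f_def prSuc)
  define m where "m = M - single (Suc i) (c - a)"
  have m: "lookup m l = (if l = Suc i then 0 else lookup M l)" for l
    using look by (auto simp: m_def lookup_minus lookup_single when_def)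
  have "m + single (Suc i) (c - a) = M"
    using look by (intro poly_mapping_eqI) (auto simp: lookup_add m lookup_single when_def)
  moreover have "(\<Sum>l<i. lookup m l) = a"
    using psum[of i] pri by (simp add: m M)
  ultimately show thesis using that[of m i] look sums m by simp
qed

section \<open>The peak functions cancel\<close>

lemma qcoeff_sum_MS:
  assumes C: "C \<subseteq> Pow {1..n}"
  shows "qcoeff (\<Sum>T\<in>C. g T *\<^sub>q MS n T) m =
    (if mdegree m = n + 1 \<and> mono_sums m \<inter> {1..n} \<in> C then g (mono_sums m \<inter> {1..n}) else 0)"
proof -
  have fin: "finite C" using C finite_subset by fastforce
  have iff: "mono_sums m = T \<union> {0, n + 1} \<longleftrightarrow> mdegree m = n + 1 \<and> T = mono_sums m \<inter> {1..n}"
    if "T \<in> C" for T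
  proof
    assume eq: "mono_sums m = T \<union> {0, n + 1}"
    have T: "T \<subseteq> {1..n}" using that C by auto
    have "Max (mono_sums m) = n + 1"
      unfolding eq using T finite_subset[OF T] by (intro Max_eqI) auto
    then show "mdegree m = n + 1 \<and> T = mono_sums m \<inter> {1..n}"
      using eq T by (auto simp: mdegree_eq_Max)
  next
    assume "mdegree m = n + 1 \<and> T = mono_sums m \<inter> {1..n}"
    moreover have "x = 0 \<or> x = n + 1 \<or> x \<in> {1..n}" if "x \<le> n + 1" for x using that by auto
    ultimately show "mono_sums m = T \<union> {0, n + 1}"
      using mono_sums_bounds[of m] by auto
  qed
  have "qcoeff (\<Sum>T\<in>C. g T *\<^sub>q MS n T) m
      = (\<Sum>T\<in>C. if T = mono_sums m \<inter> {1..n} then (if mdegree m = n + 1 then g T else 0) else 0)"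
    unfolding qcoeff_sum
  proof (rule sum.cong)
    fix T assume "T \<in> C"
    then have "qcoeff (MS n T) m = (if mdegree m = n + 1 \<and> T = mono_sums m \<inter> {1..n} then 1 else 0)"
      using qcoeff_MS[of T n m] C unfolding iff[OF \<open>T \<in> C\<close>] by blast
    then show "qcoeff (g T *\<^sub>q MS n T) m =
      (if T = mono_sums m \<inter> {1..n} then (if mdegree m = n + 1 then g T else 0) else 0)"
      by (simp add: qscale.rep_eq)
  qed simp
  then show ?thesis using fin by simp
qed

lemma card_inner_sums:
  assumes "mdegree m = n + 1"
  shows "card (mono_sums m \<inter> {1..n}) + 1 = card (mono_sums m) - 1"
proof -
  have "mono_sums m = insert 0 (insert (n + 1) (mono_sums m \<inter> {1..n}))"
    using mono_sums_bounds[of m] assms by (auto simp: le_Suc_eq)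
  then have "card (mono_sums m) = card (insert 0 (insert (n + 1) (mono_sums m \<inter> {1..n})))" by simp
  then show ?thesis by simp
qed

text \<open>
  The sets \<open>T\<close> in the definition of \<open>Theta\<close> are those that meet every pair \<open>{s - 1, s}\<close>.  As \<open>S\<close> is left
  sparse, these pairs lie in \<open>{1..n}\<close>, and \<open>T\<close> meets them exactly if
  \<open>T\<close> together with the end points \<open>0\<close> and \<open>n + 1\<close> does.
\<close>

lemma qcoeff_Theta:
  assumes S: "left_sparse n S"
  shows "qcoeff (Theta n S) m = (if mdegree m = n + 1 \<and> (\<forall>s\<in>S. mono_sums m \<inter> {s - 1, s} \<noteq> {})
     then 2 ^ (card (mono_sums m) - 1) else 0)"
proof -
  let ?T = "mono_sums m \<inter> {1..n}"
  have pair: "s - 1 \<in> {1..n}" "s \<in> {1..n}" if "s \<in> S" for s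
  proof -
    have "s \<in> {1..n}" "s \<noteq> 1" using S that by (auto simp: left_sparse_def)
    then show "s - 1 \<in> {1..n}" "s \<in> {1..n}" by auto
  qed
  have "S \<subseteq> ?T \<union> (\<lambda>i. i + 1) ` ?T \<longleftrightarrow> (\<forall>s\<in>S. mono_sums m \<inter> {s - 1, s} \<noteq> {})"
  proof -
    have "s \<in> ?T \<union> (\<lambda>i. i + 1) ` ?T \<longleftrightarrow> mono_sums m \<inter> {s - 1, s} \<noteq> {}" if "s \<in> S" for s
    proof -
      have "s \<in> (\<lambda>i. i + 1) ` ?T \<longleftrightarrow> s - 1 \<in> ?T"
        using pair[OF that] by (force simp: image_iff)
      then show ?thesis using pair[OF that] by auto
    qed
    then show ?thesis by blast
  qed
  then show ?thesis
    unfolding Theta_def by (subst qcoeff_sum_MS) (auto simp: card_inner_sums[simplified, symmetric])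
qed

text \<open>
  Summation by parts: an inner index \<open>j\<close>, with its weight \<open>2\<close>, is shared between two
  neighbouring differences.
\<close>

lemma alternating_double_sum:
  fixes h :: "nat \<Rightarrow> rat"
  shows "(\<Sum>j\<le>Suc b. (-1) ^ j * ((if 0 < j \<and> j < Suc b then 2 else 1) * h j))
      = (\<Sum>j\<le>b. (-1) ^ j * (h j - h (Suc j)))"
proof -
  have "(\<Sum>j\<le>Suc b. (-1) ^ j * ((if 0 < j \<and> j < Suc b then 2 else 1) * h j))
      = (\<Sum>j\<le>Suc b. (if j \<le> b then (-1) ^ j * h j else 0) + (if j = 0 then 0 else (-1) ^ j * h j))"
    by (intro sum.cong) auto
  also have "\<dots> = (\<Sum>j\<le>b. (-1) ^ j * h j) + (\<Sum>j\<le>Suc b. if j = 0 then 0 else (-1) ^ j * h j)"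
    by (simp add: sum.distrib)
  also have "(\<Sum>j\<le>Suc b. if j = 0 then 0 else (-1) ^ j * h j) = (\<Sum>j\<le>b. (-1) ^ Suc j * h (Suc j))"
    by (subst sum.atMost_Suc_shift) simp
  finally show ?thesis by (simp add: sum.distrib[symmetric] algebra_simps sum_subtractf sum_negf)
qed

text \<open>
  Let \<open>W\<close> be the set of partial sums when all of the exponent \<open>b\<close> is at the variable \<open>Suc i\<close>; the
  monomial with exponent \<open>j\<close> at \<open>i\<close> has one more partial sum, \<open>a + j\<close>, exactly if \<open>0 < j < b\<close>.  If \<open>W\<close>
  meets every pair \<open>{s - 1, s}\<close>, all coefficients are equal up to the weight \<open>2\<close> of inner \<open>j\<close>, and
  their alternating sum vanishes.  If \<open>W\<close> misses a pair, the new element has to meet it.  The pairs are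
  disjoint, so this is possible only when one pair is missed; since \<open>W\<close> contains the ends \<open>a\<close>
  and \<open>a + b\<close> of the gap, this pair then lies inside the gap, and its two consecutive elements
  contribute opposite terms.
\<close>

lemma cancels_Theta:
  assumes S: "left_sparse n S"
  shows "cancels (Theta n S)"
  unfolding cancels_def
proof (intro allI impI)
  fix i and m :: monomial and b :: nat
  assume m: "lookup m i = 0" "lookup m (Suc i) = 0" and "0 < b"
  then obtain b' where b: "b = Suc b'" by (cases b) auto
  define a where "a = (\<Sum>l<i. lookup m l)"
  define W where "W = mono_sums (m + single (Suc i) b)"
  define line where "line j = m + single i j + single (Suc i) (b - j)" for j
  note W = mono_sums_line[OF m, where b = b, folded a_def W_def, folded line_def]
  have finW: "finite W"
    unfolding W_def using finite_subset[OF mono_sums_bounds(2) finite_atMost] .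
  have zeroW: "0 \<in> W" unfolding W_def by (rule mono_sums_bounds)
  have cardW: "card W > 0" using finW zeroW by (auto simp: card_gt_0_iff)
  define hit where "hit V \<longleftrightarrow> (\<forall>s\<in>S. V \<inter> {s - 1, s} \<noteq> {})" for V
  define h :: "nat \<Rightarrow> rat" where "h j = of_bool (hit (insert (a + j) W))" for j
  have deg: "mdegree (line j) = mdegree m + b" if "j \<le> b" for j
  proof -
    have "mdegree (single x y) = y" for x y by (simp add: mdegree_def)
    then show ?thesis using that by (simp add: line_def mdegree_add)
  qed
  show "alt_sum i m b (Theta n S) = 0"
  proof (cases "mdegree m + b = n + 1")
    case False
    then show ?thesis
      unfolding alt_sum_def line_def[symmetric]
      by (intro sum.neutral ballI) (simp add: qcoeff_Theta[OF S] deg)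
  next
    case True
    have coeff: "qcoeff (Theta n S) (line j) = 2 ^ (card W - 1) * ((if 0 < j \<and> j < b then 2 else 1) * h j)"
      if "j \<le> b" for j
    proof -
      have "card (insert (a + j) W) = (if 0 < j \<and> j < b then card W + 1 else card W)"
      proof (cases "0 < j \<and> j < b")
        case inner: True
        then have "a + j \<notin> W" using W(4)[of "a + j"] by auto
        then show ?thesis using inner finW by simp
      next
        case False
        then have "j = 0 \<or> j = b" using that by auto
        then show ?thesis using W(2,3) by (auto simp: insert_absorb)
      qed
      moreover have "(2 :: rat) ^ card W = 2 * 2 ^ (card W - 1)"
        using cardW by (metis power_Suc Suc_diff_1)
      ultimately show ?thesis
        by (auto simp: qcoeff_Theta[OF S] deg[OF that] True W(1)[OF that] h_def hit_def)
    qed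
    have "(\<Sum>j\<le>b. (-1) ^ j * ((if 0 < j \<and> j < b then 2 else 1) * h j)) = 0"
    proof (cases "hit W")
      case True
      then have "hit (insert (a + j) W)" for j by (auto simp: hit_def)
      then have "h j = 1" for j by (simp add: h_def)
      then show ?thesis
        unfolding b alternating_double_sum by simp
    next
      case False
      then obtain s where s: "s \<in> S" "s - 1 \<notin> W" "s \<notin> W" by (auto simp: hit_def)
      show ?thesis
      proof (cases "\<exists>j\<le>b. hit (insert (a + j) W)")
        case False
        then show ?thesis by (intro sum.neutral ballI) (auto simp: h_def)
      next
        case True
        then obtain j where j: "j \<le> b" "hit (insert (a + j) W)" by blast
        have near: "a + j \<in> {s - 1, s}" using j(2) s by (auto simp: hit_def)
        have pos: "0 < s - 1" using s zeroW by (metis neq0_conv)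
        have bounds: "a < s - 1" "s < a + b"
        proof -
          have "a \<noteq> s - 1" "a \<noteq> s" "a + b \<noteq> s - 1" "a + b \<noteq> s" using s W(2,3) by auto
          then show "a < s - 1" "s < a + b" using near j(1) pos by auto
        qed
        define k where "k = s - 1 - a"
        have k: "0 < k" "Suc k < b" "a + k = s - 1" "a + Suc k = s"
          using bounds pos by (auto simp: k_def)
        have other: "W \<inter> {t - 1, t} \<noteq> {}" if "t \<in> S" "t \<noteq> s" for t
        proof
          assume t: "W \<inter> {t - 1, t} = {}"
          then have "a + j \<in> {t - 1, t}" using j(2) that by (auto simp: hit_def)
          moreover have "t - 1 \<noteq> s" "s - 1 \<noteq> t" using S s(1) that(1) by (auto simp: left_sparse_def)
          moreover have "t \<noteq> 0" using t zeroW by (cases t) auto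
          ultimately show False using near that(2) pos by auto
        qed
        have hk: "h l = of_bool (l = k \<or> l = Suc k)" for l
        proof -
          have "hit (insert (a + l) W) \<longleftrightarrow> a + l \<in> {s - 1, s}"
          proof -
            have "hit V \<longleftrightarrow> V \<inter> {s - 1, s} \<noteq> {}" if "W \<subseteq> V" for V
              unfolding hit_def using other s(1) that by (metis Int_mono order_refl subset_empty)
            from this[OF subset_insertI, of "a + l"] show ?thesis using s by auto
          qed
          also have "\<dots> \<longleftrightarrow> l = k \<or> l = Suc k" using k(3,4) by auto
          finally show ?thesis by (simp add: h_def)
        qed
        have "(\<Sum>j\<le>b. (-1) ^ j * ((if 0 < j \<and> j < b then 2 else 1) * h j))
            = (\<Sum>j\<in>{k, Suc k}. (-1) ^ j * ((if 0 < j \<and> j < b then 2 else 1) * h j))"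
          using k by (intro sum.mono_neutral_right) (auto simp: hk)
        also have "\<dots> = 0" using k by (simp add: hk)
        finally show ?thesis .
      qed
    qed
    moreover have "alt_sum i m b (Theta n S)
      = 2 ^ (card W - 1) * (\<Sum>j\<le>b. (-1) ^ j * ((if 0 < j \<and> j < b then 2 else 1) * h j))"
      unfolding alt_sum_def line_def[symmetric] sum_distrib_left
      by (intro sum.cong) (simp_all add: coeff)
    ultimately show ?thesis by simp
  qed
qed

section \<open>Cancellation and right sparse sets\<close>

lemma quasisymmetric_iff_mono_sums:
  "quasisymmetric F \<longleftrightarrow> (\<forall>m m'. mono_sums m = mono_sums m' \<longrightarrow> qcoeff F m = qcoeff F m')"
proof -
  have "exponents m = exponents m' \<longleftrightarrow> mono_sums m = mono_sums m'" for m m'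
    using list_sums_inj[OF composition_exponents[of m] composition_exponents[of m']]
    unfolding mono_sums_exponents by auto
  then show ?thesis unfolding quasisymmetric_def by simp
qed

text \<open>
  Coefficients at sets that are not right sparse are determined by the others.  If the set \<open>W\<close> of partial
  sums contains \<open>c - 1\<close> and \<open>c\<close>, where \<open>1 < c \<le> n + 1\<close>, remove \<open>c - 1\<close> and let \<open>a\<close> be the element before it.  The
  cancellation relation of the gap from \<open>a\<close> to \<open>c\<close> expresses the coefficient at \<open>W\<close> by those at sets where \<open>c - 1\<close>
  is absent or replaced by a smaller number.  These have a smaller sum of elements.
\<close>

lemma eq_zero_if_right_sparse_vanish:
  assumes quasi: "quasisymmetric G" and canc: "cancels G"
    and hom: "\<And>m. mdegree m \<noteq> n + 1 \<Longrightarrow> qcoeff G m = 0"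
    and vanish: "\<And>m. right_sparse n (mono_sums m \<inter> {1..n}) \<Longrightarrow> qcoeff G m = 0"
  shows "G = 0"
proof -
  have "qcoeff G m = 0" for m
  proof (induction "\<Sum>(mono_sums m)" arbitrary: m rule: less_induct)
    case less
    let ?W = "mono_sums m"
    have finW: "finite ?W" using finite_subset[OF mono_sums_bounds(2) finite_atMost] .
    show ?case
    proof (cases "mdegree m = n + 1 \<and> \<not> right_sparse n (?W \<inter> {1..n})")
      case False
      then show ?thesis using hom vanish by blast
    next
      case True
      have top: "n + 1 \<in> ?W" using mono_sums_bounds(1)[of m] True by simp
      obtain c where c: "c \<in> ?W" "c - 1 \<in> ?W" "1 < c"
      proof (cases "n \<in> ?W \<inter> {1..n}")
        case True
        then show thesis using that[of "n + 1"] top by auto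
      next
        case False
        with True obtain x where "x \<in> ?W" "x \<ge> 1" "x + 1 \<in> ?W" by (auto simp: right_sparse_def)
        then show thesis using that[of "x + 1"] by auto
      qed
      define V where "V = ?W - {c - 1}"
      define a where "a = Max {x \<in> V. x < c}"
      have zero: "0 \<in> V" using mono_sums_bounds(3) c by (auto simp: V_def)
      have finV: "finite V" using finW by (simp add: V_def)
      have "a \<in> {x \<in> V. x < c}"
        unfolding a_def using finV zero c by (intro Max_in) auto
      then have a: "a \<in> V" "a < c" by auto
      have gap: "x \<le> a \<or> c \<le> x" if "x \<in> V" for x
        unfolding a_def using finV that by (cases "x < c") auto
      have cV: "c \<in> V" "c - 1 \<notin> V" using c by (auto simp: V_def)
      obtain m' i where m': "lookup m' i = 0" "lookup m' (Suc i) = 0" "(\<Sum>l<i. lookup m' l) = a"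
        "mono_sums (m' + single (Suc i) (c - a)) = V"
        by (rule exists_line[OF finV zero a(1) cV(1) a(2) cV(2) gap])
      define b where "b = c - a"
      have "a \<noteq> c - 1" using a cV by auto
      then have b: "2 \<le> b" "a + b = c" using a by (auto simp: b_def)
      define line where "line j = m' + single i j + single (Suc i) (b - j)" for j
      have sums: "mono_sums (line j) = insert (a + j) V" if "j \<le> b" for j
        unfolding line_def using mono_sums_line(1)[OF m'(1,2), of j b] that m' by (simp add: b_def)
      have W: "?W = insert (c - 1) V" using c by (auto simp: V_def)
      have sumW: "\<Sum>?W = (c - 1) + \<Sum>V" using finV cV(2) by (simp add: W)
      have small: "qcoeff G (line j) = 0" if j: "j \<le> b" "j \<noteq> b - 1" for j
      proof (rule less)
        show "\<Sum>(mono_sums (line j)) < \<Sum>?W"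
        proof (cases "a + j \<in> V")
          case True
          then show ?thesis using c by (simp add: sums[OF j(1)] insert_absorb sumW)
        next
          case False
          then have "a + j \<noteq> c" using cV by auto
          then have "a + j < c - 1" using j b by auto
          then show ?thesis using False finV by (simp add: sums[OF j(1)] sumW)
        qed
      qed
      have "mono_sums (line (b - 1)) = ?W" using sums[of "b - 1"] b by (simp add: W)
      then have "qcoeff G (line (b - 1)) = qcoeff G m"
        using quasi unfolding quasisymmetric_iff_mono_sums by blast
      moreover have "alt_sum i m' b G = 0"
        using canc m' b unfolding cancels_def by simp
      moreover have "alt_sum i m' b G = (\<Sum>j\<in>{b - 1}. (-1) ^ j * qcoeff G (line j))"
        unfolding alt_sum_def line_def[symmetric]
        using small by (intro sum.mono_neutral_right) auto
      ultimately show ?thesis by simp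
    qed
  qed
  then show ?thesis by (simp add: qps_eq_iff zero_qps.rep_eq)
qed

section \<open>The algebra of cancelling quasisymmetric functions\<close>

text \<open>
  The condition on the constant term excludes \<open>1\<close>, which is quasisymmetric and cancels, but has no
  expansion in the \<open>Theta\<close>.
\<close>

definition peak_space :: "qps set" where
  "peak_space = {F. F \<in> QSym \<and> cancels F \<and> qcoeff F 0 = 0}"

lemma splits_zero: "splits 0 = {(0, 0)}"
proof -
  have "a = 0 \<and> b = 0" if "a + b = 0" for a b :: monomial
  proof -
    have "lookup a x + lookup b x = 0" for x using that by (metis lookup_add lookup_zero)
    then show ?thesis by (auto intro!: poly_mapping_eqI)
  qed
  then have "splits 0 \<subseteq> {(0, 0)}" unfolding splits_def by blast
  moreover have "(0, 0) \<in> splits 0" by (simp add: splits_def)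
  ultimately show ?thesis by blast
qed

lemma subalgebra_peak_space: "subalgebra peak_space"
  unfolding subalgebra_def
proof (intro conjI ballI)
  show "qps.subspace peak_space"
    unfolding peak_space_def qps.subspace_def QSym_def
    by (auto simp: qps_rep_eqs cancels_linear qps.span_zero qps.span_add qps.span_scale)
  show "F * G \<in> peak_space" if "F \<in> peak_space" "G \<in> peak_space" for F G
    using that by (simp add: peak_space_def QSym_times cancels_times times_qps.rep_eq splits_zero)
qed

lemma MS_in_QSym: "S \<subseteq> {1..n} \<Longrightarrow> MS n S \<in> QSym"
  unfolding MS_def QSym_def by (intro qps.span_base) (auto simp: composition_comp_of)

lemma Theta_in_peak_space: "left_sparse n S \<Longrightarrow> Theta n S \<in> peak_space"
  unfolding peak_space_def
proof (intro CollectI conjI)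
  show "Theta n S \<in> QSym"
    unfolding Theta_def QSym_def
    by (rule qps.span_sum, rule qps.span_scale) (use MS_in_QSym in \<open>auto simp: QSym_def\<close>)
qed (simp_all add: cancels_Theta qcoeff_Theta mdegree_def)

lemma peak_algebra_subset: "peak_algebra \<subseteq> peak_space"
  unfolding peak_algebra_def
  by (rule hull_minimal) (auto simp: subalgebra_peak_space Theta_in_peak_space, simp add: peak_space_def)

section \<open>Words and left sparse sets\<close>

lemma deg_simps [simp]: "deg [] = 0" "deg (w @ [Letter_c]) = deg w + 1" "deg (w @ [Letter_d]) = deg w + 2"
  by (simp_all add: deg_def)

lemma num_d_simps: "num_d [] = 0" "num_d (w @ [Letter_c]) = num_d w" "num_d (w @ [Letter_d]) = num_d w + 1"
  by (simp_all add: num_d_def count_list_append)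

lemma S_word_simps [simp]:
  "S_word [] = {}"
  "S_word (w @ [Letter_c]) = S_word w"
  "S_word (w @ [Letter_d]) = insert (deg w + 2) (S_word w)"
proof -
  have snoc: "w @ [x] = u @ [Letter_d] @ v \<longleftrightarrow>
      (v = [] \<and> u = w \<and> x = Letter_d) \<or> (\<exists>v'. v = v' @ [x] \<and> w = u @ [Letter_d] @ v')" for x u v
    by (cases v rule: rev_cases) auto
  show "S_word [] = {}" by (simp add: S_word_def)
  show "S_word (w @ [Letter_c]) = S_word w"
    unfolding S_word_def snoc by auto
  show "S_word (w @ [Letter_d]) = insert (deg w + 2) (S_word w)"
    unfolding S_word_def snoc by auto
qed

lemma S_word_bounds: "S_word w \<subseteq> {2..deg w}"
proof (induction w rule: rev_induct)
  case (snoc x w)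
  then show ?case by (cases x) auto
qed simp

lemma finite_S_word: "finite (S_word w)"
  using finite_subset[OF S_word_bounds] by simp

lemma left_sparse_S_word: "left_sparse (deg w) (S_word w)"
proof (induction w rule: rev_induct)
  case (snoc x w)
  have "Suc (deg w) \<notin> S_word w" "deg w + 2 \<notin> S_word w" "Suc (Suc (Suc (deg w))) \<notin> S_word w"
    using S_word_bounds[of w] by auto
  moreover have "i - 1 \<noteq> deg w + 2" if "i \<in> S_word w" for i
  proof -
    have "i \<le> deg w" using that S_word_bounds[of w] by auto
    then show ?thesis by simp
  qed
  ultimately show ?case
    using snoc by (cases x) (auto simp: left_sparse_def)
qed (simp add: left_sparse_def)

lemma card_S_word: "card (S_word w) = num_d w"
proof (induction w rule: rev_induct)
  case (snoc x w)
  have "Suc (Suc (deg w)) \<notin> S_word w" using S_word_bounds[of w] by auto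
  then show ?case using snoc finite_S_word by (cases x) (auto simp: num_d_simps)
qed (simp add: num_d_simps)

text \<open>
  The last letter is \<open>d\<close> exactly if the degree belongs to \<open>S_word\<close>, so words can be read off from the end.
\<close>

lemma word_eqI: "deg w = deg w' \<Longrightarrow> S_word w = S_word w' \<Longrightarrow> w = w'"
proof (induction w arbitrary: w' rule: rev_induct)
  case Nil
  then show ?case by (cases w' rule: rev_cases; cases "last w'") auto
next
  case (snoc x w)
  show ?case
  proof (cases w' rule: rev_cases)
    case Nil
    then show ?thesis using snoc.prems by (cases x) auto
  next
    case (snoc v y)
    have last: "deg (u @ [z]) \<in> S_word (u @ [z]) \<longleftrightarrow> z = Letter_d" for u z
      using S_word_bounds[of u] by (cases z) auto
    have xy: "x = y" using last[of w x] last[of v y] snoc.prems snoc by (cases x; cases y) auto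
    have notin: "Suc (Suc (deg u)) \<notin> S_word u" for u using S_word_bounds[of u] by auto
    have "deg w = deg v" using snoc.prems(1) snoc xy by (cases y) auto
    moreover have "S_word w = S_word v"
      using snoc.prems(2) snoc xy notin[of w] notin[of v] \<open>deg w = deg v\<close> by (cases y) (auto simp: insert_ident)
    ultimately show ?thesis using snoc.IH[of v] snoc xy by simp
  qed
qed

lemma left_sparse_word: "left_sparse n S \<Longrightarrow> \<exists>w. deg w = n \<and> S_word w = S"
proof (induction n arbitrary: S rule: less_induct)
  case (less n)
  show ?case
  proof (cases "n = 0")
    case True
    then show ?thesis using less.prems by (intro exI[of _ "[]"]) (auto simp: left_sparse_def)
  next
    case n: False
    show ?thesis
    proof (cases "n \<in> S")
      case True
      then have "n \<noteq> 1" "n - 1 \<notin> S" using less.prems by (auto simp: left_sparse_def)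
      then have n2: "2 \<le> n" "n - 1 \<notin> S" using n by auto
      have "x \<in> {1..n - 2}" if "x \<in> S - {n}" for x
      proof -
        have "1 \<le> x" "x \<le> n" "x \<noteq> n" "x \<noteq> n - 1"
          using that less.prems n2 by (auto simp: left_sparse_def)
        then show ?thesis by simp
      qed
      then have "left_sparse (n - 2) (S - {n})"
        using less.prems unfolding left_sparse_def by blast
      then obtain w where "deg w = n - 2" "S_word w = S - {n}" using less.IH[of "n - 2" "S - {n}"] n2 by auto
      moreover from this have "deg w + 2 = n" using n2 by simp
      ultimately have "deg (w @ [Letter_d]) = n \<and> S_word (w @ [Letter_d]) = S"
        unfolding deg_simps S_word_simps using True by blast
      then show ?thesis ..
    next
      case False
      have "x \<in> {1..n - 1}" if "x \<in> S" for x
      proof -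
        have "1 \<le> x" "x \<le> n" "x \<noteq> n" using that less.prems False by (auto simp: left_sparse_def)
        then show ?thesis by simp
      qed
      then have "left_sparse (n - 1) S"
        using less.prems unfolding left_sparse_def by blast
      then obtain w where "deg w = n - 1" "S_word w = S" using less.IH[of "n - 1" S] n by auto
      then have "deg (w @ [Letter_c]) = n \<and> S_word (w @ [Letter_c]) = S" using n by simp
      then show ?thesis ..
    qed
  qed
qed

lemma finite_words: "finite {w. deg w = n}"
proof -
  have le: "length w \<le> deg w" for w
  proof (induction w rule: rev_induct)
    case (snoc x w)
    then show ?case by (cases x) auto
  qed simp
  have "UNIV = {Letter_c, Letter_d}" using cd_letter.exhaust by auto
  then have "finite (UNIV :: cd_letter set)" by (metis finite.simps)
  then have "finite {w :: cd_word. set w \<subseteq> UNIV \<and> length w \<le> n}"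
    by (rule finite_lists_length_le)
  then show ?thesis by (rule rev_finite_subset) (use le in auto)
qed

section \<open>Matchings between sparse sets\<close>

text \<open>
  Choosing for each \<open>i \<in> R\<close> an element of \<open>R'\<close> among \<open>i - 1\<close> and \<open>i\<close> is injective, as \<open>R\<close> has no two
  consecutive elements, hence a bijection onto \<open>R'\<close>.  So \<open>R'\<close> arises from \<open>R\<close> by lowering some
  elements by one.  This makes the linear system of the cd-index triangular.
\<close>

lemma rank_decreases:
  assumes R: "left_sparse n R" and R': "finite R'" and card: "card R' = card R"
    and meet: "\<And>i. i \<in> R \<Longrightarrow> R' \<inter> {i - 1, i} \<noteq> {}"
  shows "R = R' \<or> \<Sum>R' < \<Sum>R"
proof -
  have finR: "finite R" using R finite_subset by (auto simp: left_sparse_def)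
  define g where "g i = (if i \<in> R' then i else i - 1)" for i
  have g: "g i \<in> R'" "g i \<le> i" if "i \<in> R" for i using meet[OF that] by (auto simp: g_def)
  have "inj_on g R"
  proof (rule inj_onI)
    fix i j assume ij: "i \<in> R" "j \<in> R" "g i = g j"
    have "i > 0" "j > 0" "i - 1 \<noteq> j" "j - 1 \<noteq> i"
      using ij(1,2) R by (auto simp: left_sparse_def)
    then show "i = j" using ij(3) by (auto simp: g_def split: if_splits)
  qed
  then have img: "g ` R = R'"
    using g R' card by (intro card_subset_eq) (auto simp: card_image)
  have sum: "\<Sum>R' = (\<Sum>i\<in>R. g i)"
    using \<open>inj_on g R\<close> by (simp add: img[symmetric] sum.reindex)
  show ?thesis
  proof (cases "\<forall>i\<in>R. g i = i")
    case True
    then have "R = R'" using img by auto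
    then show ?thesis ..
  next
    case False
    then obtain i where "i \<in> R" "g i < i" using g(2) by (metis le_neq_implies_less)
    then have "(\<Sum>i\<in>R. g i) < (\<Sum>i\<in>R. i)"
      using g(2) finR by (intro sum_strict_mono_ex1) auto
    then show ?thesis using sum by simp
  qed
qed

text \<open>
  Join \<open>t \<in> T\<close> to the elements of \<open>R\<close> among \<open>t\<close> and \<open>t + 1\<close>.  By sparseness every element of \<open>T\<close> and of \<open>R\<close> has at
  most one partner, so the set \<open>P\<close> of elements of \<open>T\<close> with a partner has at most \<open>card R\<close>
  elements, with equality exactly if all of \<open>R\<close> is matched.  The sets \<open>S\<close> are the subsets of \<open>P\<close> with
  \<open>card R\<close> elements: there is one, \<open>P\<close> itself, in the case of equality, and none otherwise.
\<close>

lemma card_matchings: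
  assumes T: "right_sparse n T" and R: "left_sparse n R"
  shows "card {S. S \<subseteq> T \<and> card R = card S \<and> (\<forall>i\<in>S. R \<inter> {i, i + 1} \<noteq> {})}
    = of_bool (R \<subseteq> T \<union> (\<lambda>i. i + 1) ` T)"
proof -
  have fin: "finite R" "finite T"
    using T R finite_subset by (auto simp: left_sparse_def right_sparse_def)
  define P where "P = {i \<in> T. R \<inter> {i, i + 1} \<noteq> {}}"
  have finP: "finite P" using fin by (simp add: P_def)
  define g where "g i = (if i \<in> R then i else i + 1)" for i
  have sub: "g ` P \<subseteq> R \<inter> (T \<union> (\<lambda>i. i + 1) ` T)" by (auto simp: g_def P_def)
  have inj: "inj_on g P"
  proof (rule inj_onI)
    fix i j assume ij: "i \<in> P" "j \<in> P" "g i = g j"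
    have "i + 1 \<noteq> j" "j + 1 \<noteq> i" using ij(1,2) T by (auto simp: right_sparse_def P_def)
    then show "i = j" using ij(3) by (auto simp: g_def split: if_splits)
  qed
  have le: "card P \<le> card R"
    using inj sub fin by (metis Int_subset_iff card_inj_on_le)
  have "{S. S \<subseteq> T \<and> card R = card S \<and> (\<forall>i\<in>S. R \<inter> {i, i + 1} \<noteq> {})} = {S. S \<subseteq> P \<and> card S = card R}"
    by (auto simp: P_def)
  then have count: "card {S. S \<subseteq> T \<and> card R = card S \<and> (\<forall>i\<in>S. R \<inter> {i, i + 1} \<noteq> {})} = card P choose card R"
    using n_subsets[OF finP] by simp
  show ?thesis
  proof (cases "R \<subseteq> T \<union> (\<lambda>i. i + 1) ` T")
    case True
    have "R \<subseteq> g ` P"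
    proof
      fix r assume r: "r \<in> R"
      show "r \<in> g ` P"
      proof (cases "r \<in> T")
        case True
        then have "r \<in> P" "g r = r" using r by (auto simp: P_def g_def)
        then show ?thesis by (metis imageI)
      next
        case False
        then obtain t where t: "t \<in> T" "r = t + 1" using r True by auto
        then have "t \<notin> R" using r R by (auto simp: left_sparse_def)
        then have "t \<in> P" "g t = r" using r t by (auto simp: P_def g_def)
        then show ?thesis by (metis imageI)
      qed
    qed
    then have "card P = card R"
      using le inj finP by (metis card_image card_mono finite_imageI le_antisym)
    then show ?thesis using True count by simp
  next
    case False
    have "card P \<noteq> card R"
    proof
      assume "card P = card R"
      then have "g ` P = R" using sub fin by (intro card_subset_eq) (auto simp: card_image[OF inj])
      then show False using sub False by auto
    qed
    then show ?thesis using False count le by simp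
  qed
qed

section \<open>The coordinates and the cd-index are well defined\<close>

text \<open>
  Lowering by one turns the sets \<open>S_word w\<close>, which are the left sparse sets, into the right sparse sets.  So the system
  has one equation for each word \<open>w\<close>, and by \<open>rank_decreases\<close> it is triangular for the sum of
  the elements of \<open>S_word w\<close>.
\<close>

lemma cd_index_system_ex1:
  "\<exists>!c. (\<forall>w. deg w \<noteq> n \<longrightarrow> c w = 0) \<and>
     (\<forall>S. right_sparse n S \<longrightarrow>
        k S = (\<Sum>w | deg w = n \<and> num_d w = card S \<and>
                   (\<forall>i\<in>S. S_word w \<inter> {i, i + 1} \<noteq> {}). (c w :: rat)))"
proof -
  let ?I = "{w. deg w = n}"
  define A :: "nat set \<Rightarrow> cd_word \<Rightarrow> rat" where
    "A S w = of_bool (num_d w = card S \<and> (\<forall>i\<in>S. S_word w \<inter> {i, i + 1} \<noteq> {}))" for S w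
  define down where "down w = (\<lambda>i. i - 1) ` S_word w" for w
  have pos: "i > 0" if "i \<in> S_word w" for i w using that S_word_bounds[of w] by auto
  have card_down: "card (down w) = num_d w" for w
    unfolding down_def card_S_word[symmetric] using pos
    by (intro card_image inj_onI) (metis Suc_diff_1)
  have meet_down: "(\<forall>i\<in>down w. S_word w' \<inter> {i, i + 1} \<noteq> {}) \<longleftrightarrow>
      (\<forall>i\<in>S_word w. S_word w' \<inter> {i - 1, i} \<noteq> {})" for w w'
    using pos by (auto simp: down_def)
  have sum_eq: "(\<Sum>w | deg w = n \<and> num_d w = card S \<and> (\<forall>i\<in>S. S_word w \<inter> {i, i + 1} \<noteq> {}). c w)
      = (\<Sum>w\<in>?I. A S w * c w)" for c S
    using finite_words[of n] by (intro sum.mono_neutral_cong_left) (auto simp: A_def)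
  have right_sparse_iff: "right_sparse n S \<longleftrightarrow> (\<exists>w\<in>?I. S = down w)" for S
  proof
    assume S: "right_sparse n S"
    have "1 \<le> x \<and> Suc x \<le> n \<and> x \<notin> Suc ` S" if "x \<in> S" for x
    proof -
      have "x \<in> {1..n}" "x \<noteq> n" using S that by (auto simp: right_sparse_def)
      moreover have "x \<notin> Suc ` S" using S that by (auto simp: right_sparse_def)
      ultimately show ?thesis by simp
    qed
    then have "left_sparse n (Suc ` S)"
      unfolding left_sparse_def by fastforce
    then obtain w where "deg w = n" "S_word w = Suc ` S" using left_sparse_word by blast
    then have "w \<in> ?I" "S = down w" by (simp_all add: down_def image_image)
    then show "\<exists>w\<in>?I. S = down w" by blast
  next
    assume "\<exists>w\<in>?I. S = down w"
    then obtain w where w: "deg w = n" "S = down w" by auto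
    have *: "i - 1 \<in> {1..n}" "i - 1 \<noteq> n" "i \<notin> down w" if "i \<in> S_word w" for i
    proof -
      have i: "i \<in> {2..n}" using that S_word_bounds[of w] w by auto
      then show "i - 1 \<in> {1..n}" "i - 1 \<noteq> n" by auto
      show "i \<notin> down w"
      proof
        assume "i \<in> down w"
        then obtain j where "j \<in> S_word w" "i = j - 1" by (auto simp: down_def)
        then show False using left_sparse_S_word[of w] that by (auto simp: left_sparse_def)
      qed
    qed
    have "i - 1 + 1 = i" if "i \<in> S_word w" for i using pos[OF that] by simp
    then show "right_sparse n S"
      unfolding right_sparse_def w(2) using * by (auto simp: down_def)
  qed
  have "\<exists>!c. (\<forall>w. w \<notin> ?I \<longrightarrow> c w = 0) \<and> (\<forall>w\<in>?I. k (down w) = (\<Sum>w'\<in>?I. A (down w) w' * c w'))"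
  proof (rule triangular_system_ex1[where rank = "\<lambda>w. \<Sum>(S_word w)"])
    show "finite ?I" by (rule finite_words)
    show "A (down w) w \<noteq> 0" for w
      unfolding A_def card_down meet_down by auto
    fix w w' assume w: "w \<in> ?I" "w' \<in> ?I" and "A (down w) w' \<noteq> 0"
    then have "num_d w' = num_d w" "\<forall>i\<in>S_word w. S_word w' \<inter> {i - 1, i} \<noteq> {}"
      unfolding A_def card_down meet_down of_bool_eq_0_iff by blast+
    then have "S_word w = S_word w' \<or> \<Sum>(S_word w') < \<Sum>(S_word w)"
      using left_sparse_S_word finite_S_word by (intro rank_decreases) (auto simp: card_S_word)
    then show "w = w' \<or> \<Sum>(S_word w') < \<Sum>(S_word w)"
      using w word_eqI by auto
  qed
  moreover have "(\<forall>S. (\<exists>w\<in>?I. S = down w) \<longrightarrow> P S) \<longleftrightarrow> (\<forall>w\<in>?I. P (down w))" for P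
    by blast
  ultimately show ?thesis
    unfolding sum_eq right_sparse_iff by simp
qed

lemma exists_mono_sums:
  assumes "T \<subseteq> {1..n}"
  obtains m where "mono_sums m = T \<union> {0, n + 1}" "mdegree m = n + 1"
proof -
  define m where "m = place [0..<length (comp_of n T)] (comp_of n T)"
  have "exponents m = comp_of n T"
    unfolding m_def by (simp add: exponents_place filter_composition composition_comp_of[OF assms])
  then have sums: "mono_sums m = T \<union> {0, n + 1}"
    by (simp add: mono_sums_exponents list_sums_comp_of[OF assms])
  have "mdegree m = n + 1"
    unfolding mdegree_eq_Max sums using assms finite_subset[OF assms] by (intro Max_eqI) auto
  with sums show thesis by (rule that)
qed

definition quasi_component :: "nat \<Rightarrow> qps \<Rightarrow> bool" where
  "quasi_component n H \<longleftrightarrow> quasisymmetric H \<and> (\<forall>m. mdegree m \<noteq> n + 1 \<longrightarrow> qcoeff H m = 0)"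

lemma inner_sums_determine:
  assumes "mdegree m = n + 1" "mdegree m' = n + 1" "mono_sums m \<inter> {1..n} = mono_sums m' \<inter> {1..n}"
  shows "mono_sums m = mono_sums m'"
proof -
  have "mono_sums x = insert 0 (insert (n + 1) (mono_sums x \<inter> {1..n}))" if "mdegree x = n + 1" for x
    using mono_sums_bounds[of x] that by (auto simp: le_Suc_eq)
  then show ?thesis using assms by metis
qed

lemma K_expansion_iff:
  assumes H: "quasi_component n H"
  shows "H = (\<Sum>S | S \<subseteq> {1..n}. k S *\<^sub>q K n S) \<longleftrightarrow>
    (\<forall>m. mdegree m = n + 1 \<longrightarrow> qcoeff H m =
      (\<Sum>S\<in>Pow {1..n}. (if S \<subseteq> mono_sums m \<inter> {1..n} then 2 ^ (card (mono_sums m \<inter> {1..n}) - card S) else 0) * k S))"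
proof -
  have K: "qcoeff (K n S) m = (if mdegree m = n + 1 \<and> S \<subseteq> mono_sums m \<inter> {1..n}
      then 2 ^ (card (mono_sums m \<inter> {1..n}) - card S) else 0)" for S m
    unfolding K_def by (subst qcoeff_sum_MS) auto
  have "qcoeff (\<Sum>S | S \<subseteq> {1..n}. k S *\<^sub>q K n S) m = (if mdegree m = n + 1 then
      (\<Sum>S\<in>Pow {1..n}. (if S \<subseteq> mono_sums m \<inter> {1..n} then 2 ^ (card (mono_sums m \<inter> {1..n}) - card S) else 0) * k S)
      else 0)" for m
    unfolding qcoeff_sum Pow_def[symmetric] by (auto simp: K qscale.rep_eq intro!: sum.cong)
  then show ?thesis
    using H unfolding qps_eq_iff quasi_component_def by auto
qed

text \<open>
  Comparing coefficients at a set \<open>T\<close> involves the coordinates of the subsets of \<open>T\<close> only, with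
  coefficient \<open>1\<close> for \<open>T\<close> itself; this system is triangular for the cardinality.
\<close>

lemma kcoeff_ex1:
  assumes H: "quasi_component n H"
  shows "\<exists>!k. (\<forall>S. \<not> S \<subseteq> {1..n} \<longrightarrow> k S = 0) \<and> H = (\<Sum>S | S \<subseteq> {1..n}. k S *\<^sub>q K n S)"
proof -
  define A :: "nat set \<Rightarrow> nat set \<Rightarrow> rat" where
    "A T S = (if S \<subseteq> T then 2 ^ (card T - card S) else 0)" for T S
  \<comment> \<open>the coefficient of \<open>MS n T\<close> in \<open>H\<close>\<close>
  define f where "f T = qcoeff H (SOME m. mdegree m = n + 1 \<and> mono_sums m = T \<union> {0, n + 1})" for T
  have f: "qcoeff H m = f (mono_sums m \<inter> {1..n})" if m: "mdegree m = n + 1" for m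
  proof -
    let ?m = "SOME m'. mdegree m' = n + 1 \<and> mono_sums m' = mono_sums m \<inter> {1..n} \<union> {0, n + 1}"
    have "\<exists>m'. mdegree m' = n + 1 \<and> mono_sums m' = mono_sums m \<inter> {1..n} \<union> {0, n + 1}"
      by (meson exists_mono_sums Int_lower2)
    then have "mdegree ?m = n + 1 \<and> mono_sums ?m = mono_sums m \<inter> {1..n} \<union> {0, n + 1}"
      by (rule someI_ex)
    then have "mono_sums m = mono_sums ?m"
      using m by (intro inner_sums_determine[of m n]) auto
    then show ?thesis
      using H unfolding f_def quasi_component_def quasisymmetric_iff_mono_sums by blast
  qed
  have iff: "H = (\<Sum>S | S \<subseteq> {1..n}. k S *\<^sub>q K n S) \<longleftrightarrow>
      (\<forall>T\<in>Pow {1..n}. f T = (\<Sum>S\<in>Pow {1..n}. A T S * k S))" for k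
    unfolding K_expansion_iff[OF H] A_def[symmetric]
  proof safe
    fix T assume *: "\<forall>m. mdegree m = n + 1 \<longrightarrow> qcoeff H m = (\<Sum>S\<in>Pow {1..n}. A (mono_sums m \<inter> {1..n}) S * k S)"
      and T: "T \<subseteq> {1..n}"
    obtain m where m: "mono_sums m = T \<union> {0, n + 1}" "mdegree m = n + 1"
      using exists_mono_sums[OF T] .
    have "mono_sums m \<inter> {1..n} = T" using T m by auto
    then show "f T = (\<Sum>S\<in>Pow {1..n}. A T S * k S)" using * f[OF m(2)] m(2) by metis
  qed (use f in auto)
  have "\<exists>!k. (\<forall>S. S \<notin> Pow {1..n} \<longrightarrow> k S = 0) \<and>
      (\<forall>T\<in>Pow {1..n}. f T = (\<Sum>S\<in>Pow {1..n}. A T S * k S))"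
  proof (rule triangular_system_ex1[where rank = card])
    fix T S assume "T \<in> Pow {1..n}" "A T S \<noteq> 0"
    then have "S \<subseteq> T" "finite T" by (auto simp: A_def finite_subset split: if_splits)
    then show "T = S \<or> card S < card T" using psubset_card_mono[of T S] by blast
  qed (auto simp: A_def)
  then show ?thesis unfolding iff by simp
qed

lemma qcoeff_kcoeff:
  assumes H: "quasi_component n H" and m: "mdegree m = n + 1"
  shows "qcoeff H m = (\<Sum>S\<in>Pow (mono_sums m \<inter> {1..n}).
    2 ^ (card (mono_sums m \<inter> {1..n}) - card S) * kcoeff n H S)"
proof -
  have "H = (\<Sum>S | S \<subseteq> {1..n}. kcoeff n H S *\<^sub>q K n S)"
    using theI'[OF kcoeff_ex1[OF H]] unfolding kcoeff_def by blast
  then have "qcoeff H m = (\<Sum>S\<in>Pow {1..n}. (if S \<subseteq> mono_sums m \<inter> {1..n}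
      then 2 ^ (card (mono_sums m \<inter> {1..n}) - card S) else 0) * kcoeff n H S)"
    using m unfolding K_expansion_iff[OF H] by blast
  also have "\<dots> = (\<Sum>S\<in>Pow (mono_sums m \<inter> {1..n}).
    2 ^ (card (mono_sums m \<inter> {1..n}) - card S) * kcoeff n H S)"
    by (intro sum.mono_neutral_cong_right) auto
  finally show ?thesis .
qed

lemma cd_index_spec:
  assumes "right_sparse n S"
  shows "kcoeff n H S = (\<Sum>w | deg w = n \<and> num_d w = card S \<and>
                              (\<forall>i\<in>S. S_word w \<inter> {i, i + 1} \<noteq> {}). cd_index n H w)"
  using theI'[OF cd_index_system_ex1[of n "kcoeff n H"]] assms unfolding cd_index_def by blast

lemma cd_index_zero: "cd_index n 0 = (\<lambda>_. 0)"
proof -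
  have "quasi_component n 0" by (simp add: quasi_component_def quasisymmetric_def qps_rep_eqs)
  then have "kcoeff n 0 = (\<lambda>_. 0)"
    unfolding kcoeff_def by (intro the1_equality kcoeff_ex1) auto
  then show ?thesis
    unfolding cd_index_def by (intro the1_equality cd_index_system_ex1) auto
qed

section \<open>The expansion in the peak functions\<close>

lemma alt_sum_hcomp:
  "alt_sum i m b (hcomp d F) = (if mdegree m + b = d then alt_sum i m b F else 0)"
proof -
  have "mdegree (single x y) = y" for x y by (simp add: mdegree_def)
  then show ?thesis
    unfolding alt_sum_def by (auto simp: hcomp.rep_eq mdegree_add intro!: sum.cong sum.neutral)
qed

lemma hcomp_component:
  assumes "F \<in> peak_space"
  shows "quasi_component n (hcomp (n + 1) F)" and "cancels (hcomp (n + 1) F)"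
proof -
  have quasi: "quasisymmetric F" and canc: "cancels F"
    using assms by (simp_all add: peak_space_def QSym_iff)
  have "quasisymmetric (hcomp (n + 1) F)"
    unfolding quasisymmetric_iff_mono_sums
  proof (intro allI impI)
    fix m m' assume "mono_sums m = mono_sums m'"
    moreover from this have "qcoeff F m = qcoeff F m'"
      using quasi unfolding quasisymmetric_iff_mono_sums by blast
    ultimately show "qcoeff (hcomp (n + 1) F) m = qcoeff (hcomp (n + 1) F) m'"
      by (simp add: hcomp.rep_eq mdegree_eq_Max)
  qed
  then show "quasi_component n (hcomp (n + 1) F)"
    by (simp add: quasi_component_def hcomp.rep_eq)
  show "cancels (hcomp (n + 1) F)"
    using canc by (simp add: cancels_def alt_sum_hcomp)
qed

text \<open>
  Both sides cancel, so it suffices to compare coefficients at right sparse sets \<open>T\<close>.  By the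
  definitions of \<open>K\<close> and of the cd-index, the coefficient on the left is a sum over \<open>S \<subseteq> T\<close> and over
  the words \<open>w\<close> that fit \<open>S\<close>.  Exchanging the sums, \<open>card_matchings\<close> counts the sets \<open>S\<close>
  that a word \<open>w\<close> fits: one if \<open>T\<close> occurs in \<open>Theta_word w\<close>, and none otherwise.  The powers
  of two agree because \<open>card S = num_d w\<close>.
\<close>

lemma hcomp_expansion:
  assumes F: "F \<in> peak_space"
  shows "hcomp (n + 1) F = (1 / 2) *\<^sub>q (\<Sum>w | deg w = n. c2d_coeff F w *\<^sub>q Theta_word w)"
proof -
  define H where "H = hcomp (n + 1) F"
  define c where "c = cd_index n H"
  define R where "R = (1 / 2) *\<^sub>q (\<Sum>w | deg w = n. c2d_coeff F w *\<^sub>q Theta_word w)"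
  have H: "quasi_component n H" "cancels H"
    using hcomp_component[OF F] by (simp_all add: H_def)
  have c: "c2d_coeff F w = c w / 2 ^ num_d w" if "deg w = n" for w
    using that by (simp add: c2d_coeff_def cd_coeff_def c_def H_def)
  have R_peak: "R \<in> peak_space"
    unfolding R_def Theta_word_def
    using subalgebra_peak_space left_sparse_S_word Theta_in_peak_space unfolding subalgebra_def
    by (intro qps.subspace_scale qps.subspace_sum) auto
  have Rm: "qcoeff R m = (1 / 2) * (\<Sum>w | deg w = n. c w / 2 ^ num_d w * qcoeff (Theta n (S_word w)) m)" for m
    unfolding R_def by (simp add: qscale.rep_eq qcoeff_sum c Theta_word_def)
  have "H - R = 0"
  proof (rule eq_zero_if_right_sparse_vanish[where n = n])
    show "quasisymmetric (H - R)"
    proof -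
      have "quasisymmetric H" "quasisymmetric R"
        using H R_peak by (simp_all add: peak_space_def QSym_iff quasi_component_def)
      then show ?thesis
        unfolding quasisymmetric_def minus_qps.rep_eq by metis
    qed
    show "cancels (H - R)"
      using H R_peak by (intro cancels_linear) (auto simp: peak_space_def)
    show hom: "qcoeff (H - R) m = 0" if "mdegree m \<noteq> n + 1" for m
    proof -
      have "qcoeff (Theta n (S_word w)) m = 0" if "deg w = n" for w
        using left_sparse_S_word[of w] that \<open>mdegree m \<noteq> n + 1\<close> by (simp add: qcoeff_Theta)
      then have "qcoeff R m = 0" unfolding Rm by simp
      then show ?thesis using H that by (simp add: quasi_component_def qps_rep_eqs)
    qed
    fix m assume sparse: "right_sparse n (mono_sums m \<inter> {1..n})"
    let ?T = "mono_sums m \<inter> {1..n}"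
    show "qcoeff (H - R) m = 0"
    proof (cases "mdegree m = n + 1")
      case False
      then show ?thesis by (rule hom)
    next
      case deg: True
      have sub: "right_sparse n S" if "S \<subseteq> ?T" for S
        using sparse that unfolding right_sparse_def by blast
      let ?fits = "\<lambda>S w. num_d w = card S \<and> (\<forall>i\<in>S. S_word w \<inter> {i, i + 1} \<noteq> {})"
      let ?hit = "\<lambda>w. S_word w \<subseteq> ?T \<union> (\<lambda>i. i + 1) ` ?T"
      have summand: "2 ^ (card ?T - card S) * kcoeff n H S
          = (\<Sum>w | deg w = n. of_bool (?fits S w) * (2 ^ card ?T * (c w / 2 ^ num_d w)))"
        if S: "S \<in> Pow ?T" for S
      proof -
        have "card S \<le> card ?T" using S by (intro card_mono) auto
        then have pow: "(2 :: rat) ^ (card ?T - card S) = 2 ^ card ?T / 2 ^ card S"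
          by (simp add: power_diff)
        have "kcoeff n H S = (\<Sum>w | deg w = n. of_bool (?fits S w) * c w)"
          unfolding cd_index_spec[OF sub[OF PowD[OF S]]] c_def
          using finite_words[of n] by (intro sum.mono_neutral_cong_left) auto
        then show ?thesis
          unfolding pow by (simp add: sum_distrib_left) (intro sum.cong, auto)
      qed
      have "qcoeff H m = (\<Sum>S\<in>Pow ?T. \<Sum>w | deg w = n.
          of_bool (?fits S w) * (2 ^ card ?T * (c w / 2 ^ num_d w)))"
        unfolding qcoeff_kcoeff[OF H(1) deg] by (intro sum.cong summand) simp
      also have "\<dots> = (\<Sum>w | deg w = n. (\<Sum>S\<in>Pow ?T. of_bool (?fits S w)) * (2 ^ card ?T * (c w / 2 ^ num_d w)))"
        unfolding sum_distrib_right by (rule sum.swap)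
      also have "\<dots> = (\<Sum>w | deg w = n. of_bool (?hit w) * (2 ^ card ?T * (c w / 2 ^ num_d w)))"
      proof (rule sum.cong)
        fix w assume w: "w \<in> {w. deg w = n}"
        have "(\<Sum>S\<in>Pow ?T. of_bool (?fits S w) :: rat) = of_nat (card (Pow ?T \<inter> {S. ?fits S w}))"
          by (simp add: of_bool_def sum.If_cases)
        also have "Pow ?T \<inter> {S. ?fits S w} = {S. S \<subseteq> ?T \<and> card (S_word w) = card S \<and>
            (\<forall>i\<in>S. S_word w \<inter> {i, i + 1} \<noteq> {})}"
          by (auto simp: card_S_word)
        also have "card \<dots> = of_bool (?hit w)"
          using w left_sparse_S_word[of w] by (intro card_matchings[OF sparse]) simp
        finally show "(\<Sum>S\<in>Pow ?T. of_bool (?fits S w)) * (2 ^ card ?T * (c w / 2 ^ num_d w))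
            = of_bool (?hit w) * (2 ^ card ?T * (c w / 2 ^ num_d w))" by simp
      qed simp
      also have "\<dots> = qcoeff R m"
        unfolding Rm sum_distrib_left
      proof (rule sum.cong)
        fix w
        have "qcoeff (Theta n (S_word w)) m = of_bool (?hit w) * (2 * 2 ^ card ?T)"
          unfolding Theta_def using deg by (subst qcoeff_sum_MS) auto
        then show "of_bool (?hit w) * (2 ^ card ?T * (c w / 2 ^ num_d w))
            = (1 / 2) * (c w / 2 ^ num_d w * qcoeff (Theta n (S_word w)) m)" by simp
      qed simp
      finally show ?thesis by (simp add: qps_rep_eqs)
    qed
  qed
  then show ?thesis by (simp add: H_def R_def)
qed

text \<open>
  The homogeneous components of \<open>F\<close> are expanded separately; the component of degree zero vanishes
  on \<open>peak_space\<close>, and bounded degree makes the number of words finite.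
\<close>

theorem theorem2p1:
  fixes F :: qps
  assumes "F \<in> peak_algebra"
  shows "finite {w. c2d_coeff F w \<noteq> 0} \<and>
         F = (1 / 2) *\<^sub>q (\<Sum>w | c2d_coeff F w \<noteq> 0. c2d_coeff F w *\<^sub>q Theta_word w)"
proof -
  have F: "F \<in> peak_space" using assms peak_algebra_subset by blast
  then obtain N where N: "\<And>m. mdegree m > N \<Longrightarrow> qcoeff F m = 0"
    by (auto simp: peak_space_def QSym_iff bounded_degree_def)
  have small: "deg w < N" if "c2d_coeff F w \<noteq> 0" for w
  proof (rule ccontr)
    assume "\<not> deg w < N"
    then have "hcomp (deg w + 1) F = 0"
      using N by (auto simp: qps_eq_iff hcomp.rep_eq qps_rep_eqs)
    then show False
      using that by (simp add: c2d_coeff_def cd_coeff_def cd_index_zero)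
  qed
  define D where "D = (\<Union>n<N. {w. deg w = n})"
  have finD: "finite D" unfolding D_def using finite_words by blast
  have sub: "{w. c2d_coeff F w \<noteq> 0} \<subseteq> D" using small by (auto simp: D_def)
  have "F = (\<Sum>n<N. hcomp (n + 1) F)"
  proof (unfold qps_eq_iff, intro allI)
    fix m
    have "qcoeff (\<Sum>n<N. hcomp (n + 1) F) m = (\<Sum>n<N. if n + 1 = mdegree m then qcoeff F m else 0)"
      unfolding qcoeff_sum by (intro sum.cong) (auto simp: hcomp.rep_eq)
    also have "\<dots> = qcoeff F m"
    proof (cases "mdegree m")
      case 0
      then have "m = 0" by (intro poly_mapping_eqI) (auto simp: mdegree_def in_keys_iff)
      then show ?thesis using F 0 by (simp add: peak_space_def)
    next
      case (Suc d)
      then show ?thesis using N[of m] by auto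
    qed
    finally show "qcoeff F m = qcoeff (\<Sum>n<N. hcomp (n + 1) F) m" by (rule sym)
  qed
  also have "\<dots> = (1 / 2) *\<^sub>q (\<Sum>n<N. \<Sum>w | deg w = n. c2d_coeff F w *\<^sub>q Theta_word w)"
    unfolding hcomp_expansion[OF F] by (rule qps.scale_sum_right[symmetric])
  also have "(\<Sum>n<N. \<Sum>w | deg w = n. c2d_coeff F w *\<^sub>q Theta_word w) = (\<Sum>w\<in>D. c2d_coeff F w *\<^sub>q Theta_word w)"
    unfolding D_def using finite_words by (intro sum.UNION_disjoint[symmetric]) auto
  also have "\<dots> = (\<Sum>w | c2d_coeff F w \<noteq> 0. c2d_coeff F w *\<^sub>q Theta_word w)"
    using finD sub by (intro sum.mono_neutral_right) auto
  finally show ?thesis using finite_subset[OF sub finD] by blast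
qed

end
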